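(* Let $R$ be a non-universal ceer. Then there are infinitely many pairwise $\leq$-incomparable dark ceers $(E_l)_{l\in\omega}$ such that for every $l$: $E_l\not\leq R$, and for every ceer $X$, if $X<E_l$ then $X\leq \mathrm{Id}_n$ for some $n\geq 1$.
   Context: A ceer is a computably enumerable equivalence relation on $\omega$. For equivalence relations $E,R$ on $\omega$, $E\leq R$ means there is a computable $f$ with $x\mathrel{E}y\iff f(x)\mathrel{R}f(y)$ for all $x,y$; $X<E$ means $X\leq E$ and $E\not\leq X$. A ceer is universal if every ceer is $\leq$ it. $\mathrm{Id}$ is equality on $\omega$ and, for $n\geq1$, $\mathrm{Id}_n$ is congruence modulo $n$ (a ceer with exactly $n$ classes). A ceer $R$ is dark if it has infinitely many classes and $\mathrm{Id}\not\leq R$. *)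

theory Defs
  imports Main
begin

section \<open>Computability\<close>

text \<open>
  Partial recursive functions, as programs acting on argument lists. Programs carry no arity:
  the \<open>n\<close>-ary partial recursive functions are those computed on the lists of length \<open>n\<close>.
  Composition is strict, and primitive recursion and minimisation act on the head of the list.
\<close>

datatype recf =
    Zero
  | Succ
  | Proj nat
  | Comp recf "recf list"
  | Prec recf recf
  | Mu recf

text \<open>\<open>evaluates p xs y\<close>: the program \<open>p\<close> halts on input \<open>xs\<close> with output \<open>y\<close>.\<close>

inductive evaluates :: "recf \<Rightarrow> nat list \<Rightarrow> nat \<Rightarrow> bool" where
  Zero: "evaluates Zero xs 0"
| Succ: "evaluates Succ [x] (Suc x)"
| Proj: "i < length xs \<Longrightarrow> evaluates (Proj i) xs (xs ! i)"
| Comp: "list_all2 (\<lambda>g y. evaluates g xs y) gs ys \<Longrightarrow> evaluates f ys z \<Longrightarrow>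
    evaluates (Comp f gs) xs z"
| Prec_0: "evaluates f xs y \<Longrightarrow> evaluates (Prec f g) (0 # xs) y"
| Prec_Suc: "evaluates (Prec f g) (n # xs) r \<Longrightarrow> evaluates g (n # r # xs) y \<Longrightarrow>
    evaluates (Prec f g) (Suc n # xs) y"
| Mu: "evaluates f (n # xs) 0 \<Longrightarrow> (\<forall>m<n. \<exists>y. evaluates f (m # xs) (Suc y)) \<Longrightarrow>
    evaluates (Mu f) xs n"

inductive_cases evaluates_ZeroE: "evaluates Zero xs y"
  and evaluates_SuccE: "evaluates Succ xs y"
  and evaluates_ProjE: "evaluates (Proj i) xs y"
  and evaluates_CompE: "evaluates (Comp f gs) xs y"
  and evaluates_Prec_0E: "evaluates (Prec f g) (0 # xs) y"
  and evaluates_Prec_SucE: "evaluates (Prec f g) (Suc n # xs) y"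
  and evaluates_MuE: "evaluates (Mu f) xs y"

lemma evaluates_functional: "evaluates p xs y \<Longrightarrow> evaluates p xs z \<Longrightarrow> y = z"
proof (induction arbitrary: z rule: evaluates.induct)
  case (Zero xs)
  then show ?case by (rule evaluates_ZeroE) simp
next
  case (Succ x)
  then show ?case by (rule evaluates_SuccE) simp
next
  case (Proj i xs)
  from Proj.prems show ?case by (rule evaluates_ProjE) simp
next
  case (Comp xs gs ys f z')
  from Comp.prems show ?case
  proof (rule evaluates_CompE)
    fix ys' assume ys': "list_all2 (\<lambda>g y. evaluates g xs y) gs ys'" and f: "evaluates f ys' z"
    have "ys = ys'"
    proof (rule nth_equalityI)
      show "length ys = length ys'"
        using list_all2_lengthD[OF Comp.IH(1)] list_all2_lengthD[OF ys'] by simp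
      fix i assume "i < length ys"
      then have i: "i < length gs"
        using list_all2_lengthD[OF Comp.IH(1)] by simp
      show "ys ! i = ys' ! i"
        using list_all2_nthD[OF Comp.IH(1) i] list_all2_nthD[OF ys' i] by blast
    qed
    then show ?thesis using Comp.IH(2) f by blast
  qed
next
  case (Prec_0 f xs y g)
  from Prec_0.prems show ?case by (rule evaluates_Prec_0E) (rule Prec_0.IH)
next
  case (Prec_Suc f g n xs r y)
  from Prec_Suc.prems show ?case
  proof (rule evaluates_Prec_SucE)
    fix r' assume "evaluates (Prec f g) (n # xs) r'" and g: "evaluates g (n # r' # xs) z"
    then have "r = r'" by (intro Prec_Suc.IH(1))
    with g show ?thesis by (intro Prec_Suc.IH(2)) simp
  qed
next
  case (Mu f n xs)
  from Mu.prems show ?case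
  proof (rule evaluates_MuE)
    assume z: "evaluates f (z # xs) 0" and less: "\<forall>m<z. \<exists>y. evaluates f (m # xs) (Suc y)"
    have "\<not> n < z"
    proof
      assume "n < z"
      with less obtain y where "evaluates f (n # xs) (Suc y)" by blast
      from Mu.IH(1)[OF this] show False by simp
    qed
    moreover have "\<not> z < n"
    proof
      assume "z < n"
      with Mu.IH(2) obtain y where "\<forall>v. evaluates f (z # xs) v \<longrightarrow> Suc y = v" by blast
      with z show False by blast
    qed
    ultimately show ?thesis by simp
  qed
qed

definition computable :: "(nat \<Rightarrow> nat) \<Rightarrow> bool" where
  "computable f \<longleftrightarrow> (\<exists>p. \<forall>x. evaluates p [x] (f x))"

text \<open>A binary relation is computably enumerable iff it is the domain of a partial recursive
  function of two arguments.\<close>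

definition ce_rel :: "nat rel \<Rightarrow> bool" where
  "ce_rel E \<longleftrightarrow> (\<exists>p. \<forall>x y. (x, y) \<in> E \<longleftrightarrow> (\<exists>z. evaluates p [x, y] z))"

section \<open>Ceers\<close>

definition ceer :: "nat rel \<Rightarrow> bool" where
  "ceer E \<longleftrightarrow> equiv UNIV E \<and> ce_rel E"

definition reducible :: "nat rel \<Rightarrow> nat rel \<Rightarrow> bool" (infix "\<le>\<^sub>c" 50) where
  "E \<le>\<^sub>c R \<longleftrightarrow> (\<exists>f. computable f \<and> (\<forall>x y. (x, y) \<in> E \<longleftrightarrow> (f x, f y) \<in> R))"

definition strictly_reducible :: "nat rel \<Rightarrow> nat rel \<Rightarrow> bool" (infix "<\<^sub>c" 50) where
  "X <\<^sub>c E \<longleftrightarrow> X \<le>\<^sub>c E \<and> \<not> E \<le>\<^sub>c X"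

definition universal :: "nat rel \<Rightarrow> bool" where
  "universal R \<longleftrightarrow> ceer R \<and> (\<forall>E. ceer E \<longrightarrow> E \<le>\<^sub>c R)"

definition Id_mod :: "nat \<Rightarrow> nat rel" where
  "Id_mod n = {(x, y). x mod n = y mod n}"

definition dark :: "nat rel \<Rightarrow> bool" where
  "dark R \<longleftrightarrow> ceer R \<and> infinite (UNIV // R) \<and> \<not> Id \<le>\<^sub>c R"

end

theory Submission
  imports Defs "HOL-Library.Nat_Bijection" "HOL-Library.Infinite_Set" HOL.Filter
begin

text \<open>
  Fix a ceer \<open>U\<close> that does not reduce to \<open>R\<close>. A finite injury construction builds \<open>E\<close> by merging
  classes, with two families of requirements. If the \<open>n\<close>-th program looks more and more like a
  reduction of \<open>E\<close> to \<open>R\<close>, then more and more of \<open>U\<close> is coded into \<open>E\<close>; if this went on forever,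
  \<open>U\<close> would reduce to \<open>E\<close> and \<open>E\<close> to \<open>R\<close>. And if the range of a computable function meets infinitely
  many classes, it meets every class: a value whose class is not restrained by the finitely many
  coding requirements of higher priority is merged into any class that is to be met. The second
  property gives darkness as well as minimality, because a reduction \<open>f\<close> of \<open>X\<close> to \<open>E\<close> whose range
  meets every class is inverted by searching, for \<open>y\<close>, an \<open>x\<close> with \<open>f x\<close> in the class of \<open>y\<close>.

  An infinite family is obtained by iterating: \<open>R\<close> is replaced by the join of \<open>R\<close> and \<open>E\<close>, which is
  again non-universal since \<open>E\<close> is dark. A later ceer is then not reducible to an earlier one, and
  by minimality an earlier one is not reducible to a later one either.
\<close>

section \<open>Computable functions\<close>

text \<open>Non-reducibility of \<open>E\<close> to \<open>R\<close> cannot be forced by one finite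
  action: a disagreement between \<open>E\<close> and \<open>R\<close> seen at some stage may vanish
  when \<open>R\<close> collapses later. A growing agreement test takes the place of
  diagonalization: it is passed infinitely often only by a true reduction, and each pass adds a
  further coding location for \<open>U\<close>. The argument is not effective; it considers the
  least requirement with infinitely many passes and shows that there is none. The obstacle is that
  coding must keep locations apart while the range requirements want to merge them. What resolves it
  is an asymmetry: a restraint freezes the representatives of finitely many numbers, but a protected
  class may still gain members. So a range requirement needs only one value outside the finitely
  many restrained classes, and may move it even into a restrained class. The core argument needs
  infinitely many classes in \<open>R\<close>, since otherwise a ceer with finitely many classes
  could fail to reduce to \<open>R\<close>. If \<open>R\<close> has only finitely many,
  \<open>Id\<close> takes its place, which is non-universal because of an undecidable set.\<close>

definition computable_n :: "nat \<Rightarrow> (nat list \<Rightarrow> nat) \<Rightarrow> bool" where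
  "computable_n k F \<longleftrightarrow> (\<exists>p. \<forall>xs. length xs = k \<longrightarrow> evaluates p xs (F xs))"

lemma computable_n_nth: "i < k \<Longrightarrow> computable_n k (\<lambda>xs. xs ! i)"
  unfolding computable_n_def by (rule exI[of _ "Proj i"]) (simp add: evaluates.Proj)

lemma computable_n_comp1:
  assumes "computable h" "computable_n k F"
  shows "computable_n k (\<lambda>xs. h (F xs))"
proof -
  from assms obtain p q where "\<And>x. evaluates p [x] (h x)"
    and "\<And>xs. length xs = k \<Longrightarrow> evaluates q xs (F xs)"
    unfolding computable_def computable_n_def by blast
  then show ?thesis
    unfolding computable_n_def
    by (intro exI[of _ "Comp p [q]"]) (auto intro!: evaluates.Comp[where ys = "[_]"])
qed

lemma computable_n_comp2:
  assumes "computable_n 2 H" "computable_n k F" "computable_n k G"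
  shows "computable_n k (\<lambda>xs. H [F xs, G xs])"
proof -
  from assms obtain p q r where "\<And>xs. length xs = 2 \<Longrightarrow> evaluates p xs (H xs)"
    and "\<And>xs. length xs = k \<Longrightarrow> evaluates q xs (F xs)"
    and "\<And>xs. length xs = k \<Longrightarrow> evaluates r xs (G xs)"
    unfolding computable_n_def by blast
  then show ?thesis
    unfolding computable_n_def
    by (intro exI[of _ "Comp p [q, r]"]) (auto intro!: evaluates.Comp[where ys = "[_, _]"])
qed

lemma computable_n_rec:
  assumes "computable_n k A" "computable_n (Suc (Suc k)) B"
  shows "computable_n (Suc k) (\<lambda>xs. rec_nat (A (tl xs)) (\<lambda>m r. B (m # r # tl xs)) (hd xs))"
proof -
  from assms obtain p q where p: "\<And>xs. length xs = k \<Longrightarrow> evaluates p xs (A xs)"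
    and q: "\<And>xs. length xs = Suc (Suc k) \<Longrightarrow> evaluates q xs (B xs)"
    unfolding computable_n_def by blast
  have "evaluates (Prec p q) (n # xs) (rec_nat (A xs) (\<lambda>m r. B (m # r # xs)) n)"
    if "length xs = k" for n xs
  proof (induction n)
    case 0
    then show ?case using that by (simp add: evaluates.Prec_0 p)
  next
    case (Suc n)
    have "evaluates q (n # r # xs) (B (n # r # xs))" for r using that by (simp add: q)
    then show ?case using Suc by (auto intro: evaluates.Prec_Suc)
  qed
  then show ?thesis
    unfolding computable_n_def
    by (intro exI[of _ "Prec p q"]) (auto simp: length_Suc_conv)
qed

lemma computable_n_Least:
  assumes "computable_n (Suc k) F" "\<And>xs. length xs = k \<Longrightarrow> \<exists>n. F (n # xs) = 0"
  shows "computable_n k (\<lambda>xs. LEAST n. F (n # xs) = 0)"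
proof -
  from assms obtain p where p: "\<And>xs. length xs = Suc k \<Longrightarrow> evaluates p xs (F xs)"
    unfolding computable_n_def by blast
  have "evaluates (Mu p) xs (LEAST n. F (n # xs) = 0)" if xs: "length xs = k" for xs
  proof (rule evaluates.Mu)
    have "F ((LEAST n. F (n # xs) = 0) # xs) = 0"
      using assms(2)[OF xs] by (rule LeastI_ex)
    then show "evaluates p ((LEAST n. F (n # xs) = 0) # xs) 0"
      using p[of "(LEAST n. F (n # xs) = 0) # xs"] xs by simp
    show "\<forall>m<LEAST n. F (n # xs) = 0. \<exists>y. evaluates p (m # xs) (Suc y)"
    proof (intro allI impI)
      fix m assume "m < (LEAST n. F (n # xs) = 0)"
      then have "F (m # xs) \<noteq> 0" by (rule not_less_Least)
      then show "\<exists>y. evaluates p (m # xs) (Suc y)"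
        using p[of "m # xs"] xs by (metis length_Cons not0_implies_Suc)
    qed
  qed
  then show ?thesis unfolding computable_n_def by blast
qed

lemma computable_n_1: "computable_n (Suc 0) F \<longleftrightarrow> computable (\<lambda>x. F [x])"
  unfolding computable_n_def computable_def by (auto simp: length_Suc_conv)

lemma computable_compose:
  "computable f \<Longrightarrow> computable g \<Longrightarrow> computable (\<lambda>x. f (g x))"
  using computable_n_comp1[of f "Suc 0" "\<lambda>xs. g (hd xs)"] by (simp add: computable_n_1)

lemma computable_Suc: "computable Suc"
  unfolding computable_def by (rule exI[of _ Succ]) (simp add: evaluates.Succ)

lemma computable_n_2: "computable_n 2 F \<longleftrightarrow> (\<exists>p. \<forall>x y. evaluates p [x, y] (F [x, y]))"
proof -
  have "length xs = 2 \<longleftrightarrow> (\<exists>x y. xs = [x, y])" for xs :: "nat list"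
    by (auto simp: length_Suc_conv numeral_2_eq_2)
  then show ?thesis unfolding computable_n_def by (auto 0 4)
qed

lemma computable_n_rec1:
  assumes "computable a" "computable_n 3 B"
  shows "computable_n 2 (\<lambda>xs. rec_nat (a (xs ! 1)) (\<lambda>m r. B [m, r, xs ! 1]) (xs ! 0))"
proof -
  have "computable_n (Suc (Suc 0)) (\<lambda>xs. rec_nat (a (hd (tl xs))) (\<lambda>m r. B (m # r # tl xs)) (hd xs))"
    using assms computable_n_rec[of "Suc 0" "\<lambda>xs. a (hd xs)" B]
    by (simp add: computable_n_1 numeral_3_eq_3)
  then show ?thesis
    unfolding computable_n_2 numeral_2_eq_2[symmetric] by simp
qed

lemma computable_id: "computable (\<lambda>x. x)"
  unfolding computable_def by (rule exI[of _ "Proj 0"]) 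
    (auto intro: evaluates.Proj[where i = 0, of "[x]" for x, simplified])

lemma computable_const: "computable (\<lambda>x. c)"
proof (induction c)
  case 0
  then show ?case
    unfolding computable_def by (rule exI[of _ Zero]) (simp add: evaluates.Zero)
next
  case (Suc c)
  then show ?case using computable_compose[OF computable_Suc] by simp
qed

lemma computable_n_add: "computable_n 2 (\<lambda>xs. xs ! 0 + xs ! 1)"
proof -
  have "computable_n 2 (\<lambda>xs. rec_nat (xs ! 1) (\<lambda>m r. Suc ([m, r, xs ! 1] ! 1)) (xs ! 0))"
    by (intro computable_n_rec1 computable_n_comp1[OF computable_Suc] computable_n_nth computable_id)
      simp
  moreover have "rec_nat b (\<lambda>m r. Suc r) a = a + b" for a b :: nat
    by (induction a) simp_all
  ultimately show ?thesis by simp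
qed

lemma computable_rec0:
  assumes "computable_n 2 B"
  shows "computable (\<lambda>x. rec_nat a (\<lambda>m r. B [m, r]) x)"
proof -
  have "computable_n 3 (\<lambda>xs. B [xs ! 0, xs ! 1])"
    using assms by (intro computable_n_comp2 computable_n_nth) simp_all
  from computable_n_rec1[OF computable_const this, of a]
  have "computable_n 2 (\<lambda>xs. rec_nat a (\<lambda>m r. B [m, r]) (xs ! 0))" by simp
  from computable_n_comp2[OF this, of "Suc 0" "\<lambda>xs. xs ! 0" "\<lambda>xs. xs ! 0"] show ?thesis
    by (simp add: computable_n_1 computable_id)
qed

lemma computable_pred: "computable (\<lambda>x. x - 1)"
proof -
  have "rec_nat 0 (\<lambda>m r. m) x = x - 1" for x :: nat by (cases x) simp_all
  then show ?thesis
    using computable_rec0[of "\<lambda>xs. xs ! 0" 0] by (simp add: computable_n_nth del: One_nat_def)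
qed

lemma computable_n_diff: "computable_n 2 (\<lambda>xs. xs ! 0 - xs ! 1)"
proof -
  have "computable_n 2 (\<lambda>xs. rec_nat (xs ! 1) (\<lambda>m r. [m, r, xs ! 1] ! 1 - 1) (xs ! 0))"
    by (intro computable_n_rec1 computable_n_comp1[OF computable_pred] computable_n_nth computable_id)
      simp
  moreover have "rec_nat b (\<lambda>m r. r - 1) a = b - a" for a b :: nat
    by (induction a) simp_all
  ultimately have "computable_n 2 (\<lambda>xs. xs ! 1 - xs ! 0)" by simp
  \<comment> \<open>The recursion ran on the number to be subtracted, so the arguments are swapped
    back.\<close>
  from computable_n_comp2[OF this, of 2 "\<lambda>xs. xs ! 1" "\<lambda>xs. xs ! 0"] show ?thesis
    by (simp add: computable_n_nth)
qed

lemma computable_triangle: "computable triangle"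
proof -
  have "computable_n 2 (\<lambda>xs. [xs ! 0, Suc (xs ! 1)] ! 0 + [xs ! 0, Suc (xs ! 1)] ! 1)"
    by (intro computable_n_comp2[OF computable_n_add] computable_n_comp1[OF computable_Suc]
        computable_n_nth) simp_all
  moreover have "rec_nat 0 (\<lambda>m r. Suc (m + r)) n = triangle n" for n
    by (induction n) simp_all
  ultimately show ?thesis
    using computable_rec0[of "\<lambda>xs. xs ! 0 + Suc (xs ! 1)" 0] by simp
qed

section \<open>Cantor pairing and its projections\<close>

definition npair :: "nat \<Rightarrow> nat \<Rightarrow> nat" ("\<langle>_,/ _\<rangle>") where
  "\<langle>x, y\<rangle> = prod_encode (x, y)"

definition nfst :: "nat \<Rightarrow> nat" where
  "nfst z = fst (prod_decode z)"

definition nsnd :: "nat \<Rightarrow> nat" where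
  "nsnd z = snd (prod_decode z)"

lemma nfst_npair [simp]: "nfst \<langle>x, y\<rangle> = x"
  and nsnd_npair [simp]: "nsnd \<langle>x, y\<rangle> = y"
  and npair_nfst_nsnd [simp]: "\<langle>nfst z, nsnd z\<rangle> = z"
  by (simp_all add: npair_def nfst_def nsnd_def)

lemma nfst_le: "nfst z \<le> z" and nsnd_le: "nsnd z \<le> z"
  using le_prod_encode_1[of "nfst z" "nsnd z"] le_prod_encode_2[of "nsnd z" "nfst z"]
  by (simp_all flip: npair_def)

lemma le_npair_2: "y \<le> \<langle>x, y\<rangle>"
  by (simp add: npair_def le_prod_encode_2)

lemma computable_2:
  assumes "computable_n 2 H" "computable f" "computable g"
  shows "computable (\<lambda>x. H [f x, g x])"
  using computable_n_comp2[OF assms(1), of "Suc 0" "\<lambda>xs. f (hd xs)" "\<lambda>xs. g (hd xs)"] assms(2,3)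
  by (simp add: computable_n_1)

lemma computable_add:
  "computable f \<Longrightarrow> computable g \<Longrightarrow> computable (\<lambda>x. f x + g x)"
  using computable_2[OF computable_n_add] by simp

lemma computable_diff:
  "computable f \<Longrightarrow> computable g \<Longrightarrow> computable (\<lambda>x. f x - g x)"
  using computable_2[OF computable_n_diff] by simp

lemma computable_n_npair: "computable_n 2 (\<lambda>xs. \<langle>xs ! 0, xs ! 1\<rangle>)"
proof -
  have "computable_n 2 (\<lambda>xs. [triangle ([xs ! 0, xs ! 1] ! 0 + [xs ! 0, xs ! 1] ! 1), xs ! 0] ! 0
      + [triangle ([xs ! 0, xs ! 1] ! 0 + [xs ! 0, xs ! 1] ! 1), xs ! 0] ! 1)"
    by (intro computable_n_comp2[OF computable_n_add] computable_n_comp1[OF computable_triangle]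
        computable_n_nth) simp_all
  then show ?thesis by (simp add: npair_def prod_encode_def)
qed

lemma triangle_mono: "m \<le> n \<Longrightarrow> triangle m \<le> triangle n"
  unfolding triangle_def by (intro div_le_mono mult_le_mono) simp_all

lemma npair_triangle: "\<langle>m, n\<rangle> = triangle (m + n) + m"
  by (simp add: npair_def prod_encode_def)

text \<open>The code of a pair on diagonal \<open>w\<close> lies between \<open>triangle w\<close>
  and \<open>triangle (Suc w)\<close>, and vanishing of the truncated difference says that the code
  is below the latter. So a search finds the diagonal, and subtraction then yields both
  projections.\<close>

lemma add_eq_Least_triangle: "m + n = (LEAST w. Suc \<langle>m, n\<rangle> - triangle (Suc w) = 0)"
proof (rule Least_equality[symmetric])
  show "Suc \<langle>m, n\<rangle> - triangle (Suc (m + n)) = 0"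
    by (simp add: npair_triangle)
  fix w assume "Suc \<langle>m, n\<rangle> - triangle (Suc w) = 0"
  then have "triangle (m + n) < triangle (Suc w)" by (simp add: npair_triangle del: triangle_Suc)
  then have "\<not> Suc w \<le> m + n" using triangle_mono[of "Suc w" "m + n"] by linarith
  then show "m + n \<le> w" by simp
qed

lemma nfst_add_nsnd: "nfst z + nsnd z = (LEAST w. Suc z - triangle (Suc w) = 0)"
  using add_eq_Least_triangle[of "nfst z" "nsnd z"] by (simp del: triangle_Suc)

lemma computable_nfst_add_nsnd: "computable (\<lambda>z. nfst z + nsnd z)"
proof -
  have "computable_n (Suc (Suc 0)) (\<lambda>xs. [Suc (xs ! 1), triangle (Suc (xs ! 0))] ! 0
      - [Suc (xs ! 1), triangle (Suc (xs ! 0))] ! 1)"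
    by (intro computable_n_comp2[OF computable_n_diff] computable_n_comp1[OF computable_triangle]
        computable_n_comp1[OF computable_Suc] computable_n_nth) simp_all
  then have "computable_n (Suc 0) (\<lambda>xs. LEAST n. Suc ((n # xs) ! 1) - triangle (Suc ((n # xs) ! 0)) = 0)"
  proof (intro computable_n_Least)
    fix xs :: "nat list"
    show "\<exists>n. Suc ((n # xs) ! 1) - triangle (Suc ((n # xs) ! 0)) = 0"
      by (rule exI[of _ "xs ! 0"]) simp
  qed (simp del: triangle_Suc)
  then show ?thesis unfolding computable_n_1 nfst_add_nsnd by (simp del: triangle_Suc)
qed

lemma computable_nfst: "computable f \<Longrightarrow> computable (\<lambda>x. nfst (f x))"
proof -
  have "nfst z = z - triangle (nfst z + nsnd z)" for z
    using npair_triangle[of "nfst z" "nsnd z"] by simp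
  then have "computable nfst"
    using computable_diff[OF computable_id
        computable_compose[OF computable_triangle computable_nfst_add_nsnd]] by presburger
  then show "computable f \<Longrightarrow> computable (\<lambda>x. nfst (f x))"
    by (rule computable_compose)
qed

lemma computable_nsnd: "computable f \<Longrightarrow> computable (\<lambda>x. nsnd (f x))"
proof -
  have "computable nsnd"
    using computable_diff[OF computable_nfst_add_nsnd computable_nfst[OF computable_id]] by simp
  then show "computable f \<Longrightarrow> computable (\<lambda>x. nsnd (f x))"
    by (rule computable_compose)
qed

lemma computable_npair:
  "computable f \<Longrightarrow> computable g \<Longrightarrow> computable (\<lambda>x. \<langle>f x, g x\<rangle>)"
  using computable_2[OF computable_n_npair] by simp

lemma computable_Suc': "computable f \<Longrightarrow> computable (\<lambda>x. Suc (f x))"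
  by (rule computable_compose[OF computable_Suc])

text \<open>Since \<open>computable\<close> is unary, the step function reads parameter, counter and
  previous value from one number \<open>\<langle>x, \<langle>m, r\<rangle>\<rangle>\<close>.\<close>

lemma computable_rec_nat:
  assumes "computable a" "computable (\<lambda>z. b (nfst z) (nfst (nsnd z)) (nsnd (nsnd z)))" "computable n"
  shows "computable (\<lambda>x. rec_nat (a x) (b x) (n x))"
proof -
  have "computable_n 3 (\<lambda>xs. \<langle>[xs ! 2, \<langle>[xs ! 0, xs ! 1] ! 0, [xs ! 0, xs ! 1] ! 1\<rangle>] ! 0,
      [xs ! 2, \<langle>[xs ! 0, xs ! 1] ! 0, [xs ! 0, xs ! 1] ! 1\<rangle>] ! 1\<rangle>)"
    by (intro computable_n_comp2[OF computable_n_npair] computable_n_nth) simp_all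
  from computable_n_comp1[OF assms(2) this]
  have "computable_n 3 (\<lambda>xs. b (xs ! 2) (xs ! 0) (xs ! 1))" by simp
  from computable_2[OF computable_n_rec1[OF assms(1) this] assms(3) computable_id]
  show ?thesis by (simp add: numeral_2_eq_2)
qed

section \<open>Decidable predicates and bounded quantifiers\<close>

definition decidable :: "(nat \<Rightarrow> bool) \<Rightarrow> bool" where
  "decidable P \<longleftrightarrow> computable (\<lambda>x. if P x then 1 else 0)"

lemma computable_if:
  assumes "decidable P" "computable f" "computable g"
  shows "computable (\<lambda>x. if P x then f x else g x)"
proof -
  have "computable (\<lambda>x. rec_nat (g x) (\<lambda>m r. f x) (if P x then 1 else 0))"
    using assms unfolding decidable_def
    by (intro computable_rec_nat computable_compose[OF assms(2)] computable_nfst computable_id)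
  then show ?thesis by (simp add: if_distrib cong: if_cong)
qed

lemma decidable_const: "decidable (\<lambda>x. c)"
  unfolding decidable_def by (rule computable_const)

lemma decidable_eq:
  assumes "computable f" "computable g"
  shows "decidable (\<lambda>x. f x = g x)"
proof -
  have "computable (\<lambda>x. 1 - ((f x - g x) + (g x - f x)))"
    by (intro computable_diff computable_add computable_const assms)
  moreover have "(if m = n then 1 else 0) = 1 - ((m - n) + (n - m))" for m n :: nat
    by auto
  ultimately show ?thesis by (simp add: decidable_def)
qed

lemma decidable_le:
  assumes "computable f" "computable g"
  shows "decidable (\<lambda>x. f x \<le> g x)"
proof -
  have "decidable (\<lambda>x. f x - g x = 0)"
    by (intro decidable_eq computable_diff computable_const assms)
  then show ?thesis by simp
qed

lemma decidable_less:
  assumes "computable f" "computable g"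
  shows "decidable (\<lambda>x. f x < g x)"
  using decidable_le[OF computable_Suc'[OF assms(1)] assms(2)] by (simp add: Suc_le_eq)

lemma decidable_if:
  assumes "decidable P" "decidable Q" "decidable S"
  shows "decidable (\<lambda>x. if P x then Q x else S x)"
  using computable_if[OF assms(1) assms(2,3)[unfolded decidable_def]]
  unfolding decidable_def by (rule back_subst[of computable]) auto

lemma decidable_not: "decidable P \<Longrightarrow> decidable (\<lambda>x. \<not> P x)"
  by (rule back_subst[of decidable, OF decidable_if[of P "\<lambda>x. False" "\<lambda>x. True"]])
    (auto intro: decidable_const)

lemma decidable_conj: "decidable P \<Longrightarrow> decidable Q \<Longrightarrow> decidable (\<lambda>x. P x \<and> Q x)"
  by (rule back_subst[of decidable, OF decidable_if[of P Q "\<lambda>x. False"]])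
    (auto intro: decidable_const)

lemma decidable_disj: "decidable P \<Longrightarrow> decidable Q \<Longrightarrow> decidable (\<lambda>x. P x \<or> Q x)"
  by (rule back_subst[of decidable, OF decidable_if[of P "\<lambda>x. True" Q]])
    (auto intro: decidable_const)

lemma decidable_imp: "decidable P \<Longrightarrow> decidable Q \<Longrightarrow> decidable (\<lambda>x. P x \<longrightarrow> Q x)"
  by (rule back_subst[of decidable, OF decidable_if[of P Q "\<lambda>x. True"]])
    (auto intro: decidable_const)

lemma decidable_iff: "decidable P \<Longrightarrow> decidable Q \<Longrightarrow> decidable (\<lambda>x. P x \<longleftrightarrow> Q x)"
  by (rule back_subst[of decidable, OF decidable_if[of P Q "\<lambda>x. \<not> Q x"]])
    (auto intro: decidable_const decidable_not)

lemma decidable_compose: "decidable P \<Longrightarrow> computable f \<Longrightarrow> decidable (\<lambda>x. P (f x))"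
  unfolding decidable_def by (rule computable_compose)

lemma computable_Least:
  assumes "decidable (\<lambda>z. P (nfst z) (nsnd z))" "\<And>x. \<exists>y. P x y"
  shows "computable (\<lambda>x. LEAST y. P x y)"
proof -
  have "computable_n 2 (\<lambda>xs. \<langle>[xs ! 1, xs ! 0] ! 0, [xs ! 1, xs ! 0] ! 1\<rangle>)"
    by (intro computable_n_comp2[OF computable_n_npair] computable_n_nth) simp_all
  from computable_n_comp1[OF decidable_not[OF assms(1), unfolded decidable_def] this]
  have "computable_n (Suc (Suc 0)) (\<lambda>xs. if \<not> P (xs ! 1) (xs ! 0) then 1 else 0)"
    by (simp add: numeral_2_eq_2 cong: if_cong)
  then have "computable_n (Suc 0)
      (\<lambda>xs. LEAST n. (if \<not> P ((n # xs) ! 1) ((n # xs) ! 0) then 1 else 0) = (0::nat))"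
    by (rule computable_n_Least) (use assms(2) in auto)
  moreover have "(if \<not> p then 1 else 0) = (0::nat) \<longleftrightarrow> p" for p by simp
  ultimately show ?thesis by (simp add: computable_n_1)
qed

lemma decidable_bex:
  assumes "decidable (\<lambda>z. P (nfst z) (nsnd z))" "computable b"
  shows "decidable (\<lambda>x. \<exists>y<b x. P x y)"
proof -
  \<comment> \<open>The disjunct \<open>b x \<le> y\<close> makes the search stop at the bound when
    no witness lies below it.\<close>
  have "computable (\<lambda>x. LEAST y. P x y \<or> b x \<le> y)"
    by (intro computable_Least decidable_disj decidable_le computable_compose[OF assms(2)] assms(1)
        computable_nfst computable_nsnd computable_id) auto
  then have "decidable (\<lambda>x. (LEAST y. P x y \<or> b x \<le> y) < b x)"
    by (rule decidable_less[OF _ assms(2)])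
  moreover have "(LEAST y. P x y \<or> b x \<le> y) < b x \<longleftrightarrow> (\<exists>y<b x. P x y)" for x
  proof
    let ?y = "LEAST y. P x y \<or> b x \<le> y"
    have "P x ?y \<or> b x \<le> ?y" by (rule LeastI[of _ "b x"]) simp
    then show "?y < b x \<Longrightarrow> \<exists>y<b x. P x y" by auto
    show "?y < b x" if "\<exists>y<b x. P x y"
    proof -
      from that obtain y where "y < b x" "P x y" by blast
      moreover from this have "?y \<le> y" by (intro Least_le) simp
      ultimately show ?thesis by simp
    qed
  qed
  ultimately show ?thesis by simp
qed

lemma decidable_ball:
  assumes "decidable (\<lambda>z. P (nfst z) (nsnd z))" "computable b"
  shows "decidable (\<lambda>x. \<forall>y<b x. P x y)"
  using decidable_not[OF decidable_bex[of "\<lambda>x y. \<not> P x y", OF decidable_not[OF assms(1)] assms(2)]]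
  by simp

lemma computable_card_less:
  assumes "decidable (\<lambda>z. P (nfst z) (nsnd z))" "computable b"
  shows "computable (\<lambda>x. card {t. t < b x \<and> P x t})"
proof -
  have "decidable (\<lambda>z. P (nfst z) (nfst (nsnd z)))"
    using decidable_compose[OF assms(1), of "\<lambda>z. \<langle>nfst z, nfst (nsnd z)\<rangle>"]
    by (simp add: computable_npair computable_nfst computable_nsnd computable_id)
  then have "computable (\<lambda>x. rec_nat 0 (\<lambda>t r. if P x t then Suc r else r) (b x))"
    by (intro computable_rec_nat computable_if computable_const assms(2) computable_Suc'
        computable_nsnd computable_id)
  moreover have "card {t. t < n \<and> P x t} = rec_nat 0 (\<lambda>t r. if P x t then Suc r else r) n" for n x
  proof (induction n)
    case (Suc n)
    have "{t. t < Suc n \<and> P x t} = (if P x n then insert n {t. t < n \<and> P x t} else {t. t < n \<and> P x t})"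
      by (auto simp: less_Suc_eq)
    then show ?case using Suc by simp
  qed simp
  ultimately show ?thesis by simp
qed

lemma computable_compose2:
  assumes "computable (\<lambda>z. h (nfst z) (nsnd z))" "computable f" "computable g"
  shows "computable (\<lambda>x. h (f x) (g x))"
  using computable_compose[OF assms(1) computable_npair[OF assms(2,3)]] by simp

lemma computable_compose3:
  assumes "computable (\<lambda>z. h (nfst z) (nfst (nsnd z)) (nsnd (nsnd z)))"
    "computable f" "computable g" "computable k"
  shows "computable (\<lambda>x. h (f x) (g x) (k x))"
  using computable_compose[OF assms(1) computable_npair[OF assms(2) computable_npair[OF assms(3,4)]]]
  by simp

lemma decidable_compose3:
  assumes "decidable (\<lambda>z. h (nfst z) (nfst (nsnd z)) (nsnd (nsnd z)))"
    "computable f" "computable g" "computable k"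
  shows "decidable (\<lambda>x. h (f x) (g x) (k x))"
  using decidable_compose[OF assms(1) computable_npair[OF assms(2) computable_npair[OF assms(3,4)]]]
  by simp

text \<open>The rules are stated for composed arguments, so that repeated introduction follows the
  syntax of a definition and proves its computability.\<close>

named_theorems computable_intros

lemmas [computable_intros] =
  computable_id computable_const computable_Suc' computable_add computable_diff
  computable_nfst computable_nsnd computable_npair computable_if computable_rec_nat
  computable_card_less decidable_const decidable_eq decidable_le decidable_less decidable_if
  decidable_not decidable_conj decidable_disj decidable_imp decidable_iff decidable_bex
  decidable_ball

section \<open>Recursion on finite tables\<close>

declare list_encode.simps(2) [simp del] list_decode.simps(2) [simp del]

text \<open>Acts on \<open>list_encode\<close> codes, where
  \<open>Suc \<langle>x, l\<rangle>\<close> is a cons cell. The code 0 of the empty list is a fixed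
  point of the tail step, so dropping past the end is harmless.\<close>

definition dropc :: "nat \<Rightarrow> nat \<Rightarrow> nat" where
  "dropc l i = rec_nat l (\<lambda>_ r. nsnd (r - 1)) i"

definition nthc :: "nat \<Rightarrow> nat \<Rightarrow> nat" where
  "nthc l i = nfst (dropc l i - 1)"

definition lengthc :: "nat \<Rightarrow> nat" where
  "lengthc l = (LEAST k. dropc l k = 0)"

lemma nfst_0 [simp]: "nfst 0 = 0" and nsnd_0 [simp]: "nsnd 0 = 0"
  using nfst_le[of 0] nsnd_le[of 0] by simp_all

lemma list_encode_Cons: "list_encode (x # xs) = Suc \<langle>x, list_encode xs\<rangle>"
  by (simp add: npair_def list_encode.simps(2))

lemma list_decode_Suc_npair: "list_decode (Suc \<langle>x, l\<rangle>) = x # list_decode l"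
  by (metis list_decode_inverse list_encode_Cons list_encode_inverse)

lemma dropc_eq: "dropc l i = list_encode (drop i (list_decode l))"
proof (induction i)
  case (Suc i)
  have "nsnd (list_encode xs - 1) = list_encode (tl xs)" for xs
    by (cases xs) (simp_all add: list_encode_Cons)
  then show ?case using Suc by (simp add: dropc_def drop_Suc tl_drop)
qed (simp add: dropc_def)

lemma nthc_eq: "i < length (list_decode l) \<Longrightarrow> nthc l i = list_decode l ! i"
  by (simp add: nthc_def dropc_eq Cons_nth_drop_Suc[symmetric] list_encode_Cons
     )

lemma list_encode_eq_0: "list_encode xs = 0 \<longleftrightarrow> xs = []"
  by (cases xs) (simp_all add: list_encode_Cons)

lemma lengthc_eq: "lengthc l = length (list_decode l)"
  unfolding lengthc_def by (rule Least_equality) (simp_all add: dropc_eq list_encode_eq_0)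

lemma computable_dropc:
  "computable f \<Longrightarrow> computable g \<Longrightarrow> computable (\<lambda>x. dropc (f x) (g x))"
  unfolding dropc_def by (intro computable_intros)

lemma computable_nthc:
  "computable f \<Longrightarrow> computable g \<Longrightarrow> computable (\<lambda>x. nthc (f x) (g x))"
  unfolding nthc_def by (intro computable_intros computable_dropc)

lemma computable_lengthc: "computable f \<Longrightarrow> computable (\<lambda>x. lengthc (f x))"
proof -
  have "\<exists>k. dropc l k = 0" for l
    by (rule exI[of _ "length (list_decode l)"]) (simp add: dropc_eq)
  then have "computable lengthc"
    unfolding lengthc_def
    by (intro computable_Least computable_intros computable_dropc)
  then show "computable f \<Longrightarrow> computable (\<lambda>x. lengthc (f x))"
    by (rule computable_compose)
qed

definition table :: "nat \<Rightarrow> (nat \<Rightarrow> nat) \<Rightarrow> nat" where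
  "table n g = rec_nat 0 (\<lambda>k r. Suc \<langle>g k, r\<rangle>) n"

text \<open>A table grows by consing, so the entry for \<open>i\<close> sits at position
  \<open>n - Suc i\<close>.\<close>

definition lookup :: "nat \<Rightarrow> nat \<Rightarrow> nat \<Rightarrow> nat" where
  "lookup n t i = (if i < n then nthc t (n - Suc i) else 0)"

lemma list_decode_table: "list_decode (table n g) = rev (map g [0..<n])"
  by (induction n) (simp_all add: table_def list_decode_Suc_npair)

lemma lookup_table: "lookup n (table n g) i = (if i < n then g i else 0)"
  by (simp add: lookup_def nthc_eq list_decode_table rev_nth)

lemma computable_lookup:
  "computable f \<Longrightarrow> computable g \<Longrightarrow> computable h \<Longrightarrow> computable (\<lambda>x. lookup (f x) (g x) (h x))"
  unfolding lookup_def by (intro computable_intros computable_nthc)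

text \<open>The operator \<open>G\<close> receives the finite table of the previous stage as an oracle \<open>h\<close>; its
  computability is only required for oracles of this form.\<close>

lemma computable_table_rec:
  assumes f0: "\<And>z. f 0 z = 0"
    and f_Suc: "\<And>s z. f (Suc s) z = (if z \<le> s then G s (f s) z else 0)"
    and G: "\<And>h. computable (\<lambda>z. h (nfst z) (nsnd z)) \<Longrightarrow>
      computable (\<lambda>w. G (nfst w) (h w) (nsnd (nsnd w)))"
  shows "computable (\<lambda>z. f (nfst z) (nsnd z))"
proof -
  define T where "T s = table s (f s)" for s
  \<comment> \<open>Outside the table \<open>f s\<close> has exactly the default value of
    \<open>lookup\<close>, so a finite code carries the whole function.\<close>
  have zero: "f s z = 0" if "s \<le> z" for s z
    using that by (cases s) (simp_all add: f0 f_Suc)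
  have look: "lookup s (T s) = f s" for s
    by (rule ext) (simp add: T_def lookup_table zero)
  define G' where "G' s t z = G s (lookup s t) z" for s t z
  have "computable (\<lambda>w. G (nfst w) (lookup (nfst w) (nfst (nsnd w))) (nsnd (nsnd w)))"
    by (rule G) (intro computable_lookup computable_intros)
  then have G': "computable (\<lambda>w. G' (nfst w) (nfst (nsnd w)) (nsnd (nsnd w)))"
    by (simp add: G'_def)
  have T_eq: "T s = rec_nat 0 (\<lambda>s t. table (Suc s) (G' s t)) s" for s
  proof (induction s)
    case (Suc s)
    have "T (Suc s) = table (Suc s) (G' s (T s))"
    proof -
      have "table n (f (Suc s)) = table n (G' s (T s))" if "n \<le> Suc s" for n
        using that by (induction n) (simp_all add: table_def G'_def look f_Suc)
      then show ?thesis by (simp add: T_def)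
    qed
    then show ?case using Suc by simp
  qed (simp add: T_def table_def)
  have "T = (\<lambda>s. rec_nat 0 (\<lambda>s t. table (Suc s) (G' s t)) s)"
    by (rule ext) (rule T_eq)
  moreover have "computable (\<lambda>s. rec_nat 0 (\<lambda>s t. table (Suc s) (G' s t)) s)"
    unfolding table_def by (intro computable_intros computable_compose3[of G', OF G'])
  ultimately have T: "computable T" by (simp only:)
  then have "computable (\<lambda>z. lookup (nfst z) (T (nfst z)) (nsnd z))"
    by (intro computable_lookup computable_intros computable_compose[OF T])
  then show ?thesis by (simp add: look)
qed

section \<open>A universal machine\<close>

lemma in_list_decode_le: "x \<in> set (list_decode l) \<Longrightarrow> x \<le> l"
proof (induction l rule: less_induct)
  case (less l)
  show ?case
  proof (cases l)
    case (Suc n)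
    then have "x = nfst n \<or> x \<in> set (list_decode (nsnd n))"
      using less.prems by (cases "prod_decode n") (simp add: nfst_def nsnd_def list_decode.simps(2))
    then show ?thesis
      using less.IH[of "nsnd n"] Suc nfst_le[of n] nsnd_le[of n] by auto
  qed (use less.prems in simp)
qed

text \<open>For the termination of \<open>prog\<close>: a code with nonzero tag lies strictly beyond
  \<open>\<langle>0, nsnd c\<rangle>\<close>, which is at least \<open>nsnd c\<close>.\<close>

lemma nsnd_less: "nfst c \<noteq> 0 \<Longrightarrow> nsnd c < c"
  using npair_triangle[of "nfst c" "nsnd c"] npair_triangle[of 0 "nsnd c"] le_npair_2[of "nsnd c" 0]
    triangle_mono[of "nsnd c" "nfst c + nsnd c"] by simp

text \<open>Every number is a program, all tags from 5 on meaning \<open>Mu\<close>. The numbering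
  is onto but not injective.\<close>

function prog :: "nat \<Rightarrow> recf" where
  "prog c =
    (if nfst c = 0 then Zero
     else if nfst c = 1 then Succ
     else if nfst c = 2 then Proj (nsnd c)
     else if nfst c = 3 then Comp (prog (nfst (nsnd c))) (map prog (list_decode (nsnd (nsnd c))))
     else if nfst c = 4 then Prec (prog (nfst (nsnd c))) (prog (nsnd (nsnd c)))
     else Mu (prog (nsnd c)))"
  by auto
termination
proof (relation "measure id", goal_cases)
  case (3 c x)
  then show ?case
    using in_list_decode_le[of x "nsnd (nsnd c)"] nsnd_le[of "nsnd c"] nsnd_less[of c] by simp
qed (auto intro: nsnd_less le_less_trans[OF nfst_le nsnd_less] le_less_trans[OF nsnd_le nsnd_less])

declare prog.simps [simp del]

lemma prog_surj: "\<exists>c. prog c = p"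
proof (induction p)
  case Zero
  have "prog \<langle>0, 0\<rangle> = Zero" by (simp add: prog.simps)
  then show ?case ..
next
  case Succ
  have "prog \<langle>1, 0\<rangle> = Succ" by (simp add: prog.simps)
  then show ?case ..
next
  case (Proj i)
  have "prog \<langle>2, i\<rangle> = Proj i" by (simp add: prog.simps)
  then show ?case ..
next
  case (Comp f gs)
  from Comp(1) obtain c where c: "prog c = f" ..
  from Comp(2) have "\<exists>cs. map prog cs = gs"
  proof (induction gs)
    case (Cons g gs)
    then obtain d cs where "prog d = g" "map prog cs = gs" by fastforce
    then have "map prog (d # cs) = g # gs" by simp
    then show ?case ..
  qed simp
  then obtain cs where "map prog cs = gs" ..
  then have "prog \<langle>3, \<langle>c, list_encode cs\<rangle>\<rangle> = Comp f gs"
    using c by (subst prog.simps) simp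
  then show ?case ..
next
  case (Prec f g)
  then obtain c d where "prog c = f" "prog d = g" by blast
  then have "prog \<langle>4, \<langle>c, d\<rangle>\<rangle> = Prec f g"
    by (subst prog.simps) simp
  then show ?case ..
next
  case (Mu f)
  then obtain c where "prog c = f" ..
  then have "prog \<langle>5, c\<rangle> = Mu f"
    by (subst prog.simps) simp
  then show ?case ..
qed

text \<open>One application of a rule of \<open>evaluates\<close> to codes, the premises being
  looked up in \<open>D\<close>. The bound \<open>s\<close> on intermediate results makes this
  decidable relative to \<open>D\<close>.\<close>

definition justified :: "(nat \<Rightarrow> bool) \<Rightarrow> nat \<Rightarrow> nat \<Rightarrow> nat \<Rightarrow> nat \<Rightarrow> bool" where
  "justified D s p xs y \<longleftrightarrow>
    nfst p = 0 \<and> y = 0 \<or>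
    nfst p = 1 \<and> lengthc xs = 1 \<and> y = Suc (nthc xs 0) \<or>
    nfst p = 2 \<and> nsnd p < lengthc xs \<and> y = nthc xs (nsnd p) \<or>
    nfst p = 3 \<and> (\<exists>ys<s. lengthc ys = lengthc (nsnd (nsnd p)) \<and>
      (\<forall>i<lengthc ys. D \<langle>nthc (nsnd (nsnd p)) i, \<langle>xs, nthc ys i\<rangle>\<rangle>) \<and>
      D \<langle>nfst (nsnd p), \<langle>ys, y\<rangle>\<rangle>) \<or>
    nfst p = 4 \<and> 0 < lengthc xs \<and>
      (nthc xs 0 = 0 \<and> D \<langle>nfst (nsnd p), \<langle>dropc xs 1, y\<rangle>\<rangle> \<or>
       0 < nthc xs 0 \<and> (\<exists>r<s. D \<langle>p, \<langle>Suc \<langle>nthc xs 0 - 1, dropc xs 1\<rangle>, r\<rangle>\<rangle> \<and>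
         D \<langle>nsnd (nsnd p), \<langle>Suc \<langle>nthc xs 0 - 1, Suc \<langle>r, dropc xs 1\<rangle>\<rangle>, y\<rangle>\<rangle>)) \<or>
    4 < nfst p \<and> D \<langle>nsnd p, \<langle>Suc \<langle>y, xs\<rangle>, 0\<rangle>\<rangle> \<and>
      (\<forall>m<y. \<exists>r<s. D \<langle>nsnd p, \<langle>Suc \<langle>m, xs\<rangle>, Suc r\<rangle>\<rangle>)"

text \<open>\<open>derived s \<langle>p, \<langle>xs, y\<rangle>\<rangle> = 1\<close> iff within \<open>s\<close> stages a derivation of
  \<open>evaluates (prog p) (list_decode xs) y\<close> has been found.\<close>

fun derived :: "nat \<Rightarrow> nat \<Rightarrow> nat" where
  "derived 0 z = 0"
| "derived (Suc s) z =
    (if z \<le> s then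
      (if derived s z = 1 \<or>
          justified (\<lambda>u. derived s u = 1) s (nfst z) (nfst (nsnd z)) (nsnd (nsnd z))
       then 1 else 0)
     else 0)"

lemma computable_derived:
  "computable f \<Longrightarrow> computable g \<Longrightarrow> computable (\<lambda>x. derived (f x) (g x))"
proof -
  have "computable (\<lambda>z. derived (nfst z) (nsnd z))"
  proof (rule computable_table_rec[where G = "\<lambda>s h z. if h z = 1 \<or>
          justified (\<lambda>u. h u = 1) s (nfst z) (nfst (nsnd z)) (nsnd (nsnd z)) then 1 else 0"])
    fix h assume h: "computable (\<lambda>z. h (nfst z) (nsnd z))"
    show "computable (\<lambda>w. if h w (nsnd (nsnd w)) = 1 \<or>
          justified (\<lambda>u. h w u = 1) (nfst w) (nfst (nsnd (nsnd w)))
            (nfst (nsnd (nsnd (nsnd w)))) (nsnd (nsnd (nsnd (nsnd w)))) then 1 else 0)"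
      unfolding justified_def
      by (intro computable_intros computable_compose2[of h, OF h] computable_nthc
          computable_lengthc computable_dropc)
  qed simp_all
  then show "computable f \<Longrightarrow> computable g \<Longrightarrow> computable (\<lambda>x. derived (f x) (g x))"
    by (rule computable_compose2[of derived])
qed

lemma derived_Suc: "derived s z = 1 \<Longrightarrow> derived (Suc s) z = 1"
proof -
  assume z: "derived s z = 1"
  then have "z < s" by (cases s) (auto split: if_splits)
  with z show ?thesis by simp
qed

lemma derived_mono: "s \<le> s' \<Longrightarrow> derived s z = 1 \<Longrightarrow> derived s' z = 1"
  by (induction s' rule: dec_induct) (blast intro: derived_Suc)+

declare derived.simps [simp del]

lemma list_decode_dropc: "list_decode (dropc l i) = drop i (list_decode l)"
  by (simp add: dropc_eq)

lemma evaluates_if_justified: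
  assumes "justified D s p xs y"
    and D: "\<And>p xs y. D \<langle>p, \<langle>xs, y\<rangle>\<rangle> \<Longrightarrow> evaluates (prog p) (list_decode xs) y"
  shows "evaluates (prog p) (list_decode xs) y"
proof -
  let ?xs = "list_decode xs"
  note code = lengthc_eq nthc_eq list_decode_dropc list_decode_Suc_npair
  from assms(1) consider
      (Zero) "nfst p = 0" "y = 0"
    | (Succ) "nfst p = 1" "lengthc xs = 1" "y = Suc (nthc xs 0)"
    | (Proj) "nfst p = 2" "nsnd p < lengthc xs" "y = nthc xs (nsnd p)"
    | (Comp) ys where "nfst p = 3" "lengthc ys = lengthc (nsnd (nsnd p))"
        "\<forall>i<lengthc ys. D \<langle>nthc (nsnd (nsnd p)) i, \<langle>xs, nthc ys i\<rangle>\<rangle>"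
        "D \<langle>nfst (nsnd p), \<langle>ys, y\<rangle>\<rangle>"
    | (Prec_0) "nfst p = 4" "0 < lengthc xs" "nthc xs 0 = 0"
        "D \<langle>nfst (nsnd p), \<langle>dropc xs 1, y\<rangle>\<rangle>"
    | (Prec_Suc) r where "nfst p = 4" "0 < lengthc xs" "0 < nthc xs 0"
        "D \<langle>p, \<langle>Suc \<langle>nthc xs 0 - 1, dropc xs 1\<rangle>, r\<rangle>\<rangle>"
        "D \<langle>nsnd (nsnd p), \<langle>Suc \<langle>nthc xs 0 - 1, Suc \<langle>r, dropc xs 1\<rangle>\<rangle>, y\<rangle>\<rangle>"
    | (Mu) "4 < nfst p" "D \<langle>nsnd p, \<langle>Suc \<langle>y, xs\<rangle>, 0\<rangle>\<rangle>"
        "\<forall>m<y. \<exists>r<s. D \<langle>nsnd p, \<langle>Suc \<langle>m, xs\<rangle>, Suc r\<rangle>\<rangle>"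
    unfolding justified_def by (elim disjE exE conjE; blast)
  then show ?thesis
  proof cases
    case Zero
    then show ?thesis by (simp add: prog.simps evaluates.Zero)
  next
    case Succ
    then obtain x where "?xs = [x]" by (auto simp: lengthc_eq length_Suc_conv)
    with Succ show ?thesis
      by (simp add: prog.simps code evaluates.Succ)
  next
    case Proj
    then show ?thesis by (simp add: prog.simps code evaluates.Proj)
  next
    case (Comp ys)
    have "prog p = Comp (prog (nfst (nsnd p))) (map prog (list_decode (nsnd (nsnd p))))"
      using Comp(1) by (subst prog.simps) simp
    moreover have "list_all2 (\<lambda>g. evaluates g ?xs) (map prog (list_decode (nsnd (nsnd p))))
        (list_decode ys)"
      using Comp(2,3) D by (auto simp: list_all2_conv_all_nth code)
    ultimately show ?thesis
      using D[OF Comp(4)] by (auto intro: evaluates.Comp)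
  next
    case Prec_0
    have "prog p = Prec (prog (nfst (nsnd p))) (prog (nsnd (nsnd p)))"
      using Prec_0(1) by (subst prog.simps) simp
    moreover have "?xs = 0 # drop 1 ?xs"
      using Prec_0(2,3) by (cases ?xs) (simp_all add: code)
    ultimately show ?thesis
      using D[OF Prec_0(4)] evaluates.Prec_0 by (metis list_decode_dropc)
  next
    case (Prec_Suc r)
    have "prog p = Prec (prog (nfst (nsnd p))) (prog (nsnd (nsnd p)))"
      using Prec_Suc(1) by (subst prog.simps) simp
    moreover obtain n ns where xs: "?xs = Suc n # ns"
      using Prec_Suc(2,3) by (cases ?xs; cases "hd ?xs") (simp_all add: code)
    ultimately show ?thesis
      using D[OF Prec_Suc(4)] D[OF Prec_Suc(5)]
      by (auto simp: code intro: evaluates.Prec_Suc)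
  next
    case Mu
    have "prog p = Mu (prog (nsnd p))"
      using Mu(1) by (subst prog.simps) simp
    moreover have "evaluates (Mu (prog (nsnd p))) ?xs y"
      using D[OF Mu(2)] Mu(3) D by (intro evaluates.Mu) (auto simp: code, metis code(4))
    ultimately show ?thesis by simp
  qed
qed

lemma derived_Suc_iff:
  "derived (Suc s) z = 1 \<longleftrightarrow>
    z \<le> s \<and> (derived s z = 1 \<or>
      justified (\<lambda>u. derived s u = 1) s (nfst z) (nfst (nsnd z)) (nsnd (nsnd z)))"
  by (subst derived.simps) (simp split: if_splits)

lemma evaluates_if_derived:
  "derived s \<langle>p, \<langle>xs, y\<rangle>\<rangle> = 1 \<Longrightarrow> evaluates (prog p) (list_decode xs) y"
proof (induction s arbitrary: p xs y)
  case 0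
  then show ?case by (subst (asm) derived.simps) simp
next
  case (Suc s)
  from Suc.prems have "derived s \<langle>p, \<langle>xs, y\<rangle>\<rangle> = 1 \<or> justified (\<lambda>u. derived s u = 1) s p xs y"
    unfolding derived_Suc_iff nfst_npair nsnd_npair by blast
  then show ?case
  proof
    assume "justified (\<lambda>u. derived s u = 1) s p xs y"
    then show ?thesis by (rule evaluates_if_justified) (rule Suc.IH)
  qed (rule Suc.IH)
qed

text \<open>A fact justified at stage \<open>s\<close> is recorded at stage \<open>Suc s\<close>
  once its code is at most \<open>s\<close>; both conditions hold from some stage on.\<close>

lemma eventually_derivedI:
  assumes "\<forall>\<^sub>F s in sequentially. justified (\<lambda>u. derived s u = 1) s p xs y"
  shows "\<forall>\<^sub>F s in sequentially. derived s \<langle>p, \<langle>xs, y\<rangle>\<rangle> = 1"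
proof -
  have "\<forall>\<^sub>F s in sequentially. derived (Suc s) \<langle>p, \<langle>xs, y\<rangle>\<rangle> = 1"
    using assms eventually_ge_at_top[of "\<langle>p, \<langle>xs, y\<rangle>\<rangle>"]
    by eventually_elim (unfold derived_Suc_iff nfst_npair nsnd_npair, blast)
  then show ?thesis by (rule eventually_sequentially_Suc[THEN iffD1])
qed

text \<open>A rule has finitely many premises, each derived from some stage on, hence all are
  derived together from a common stage on; for \<open>Comp\<close> and \<open>Mu\<close> this is a
  finite intersection of eventual statements.\<close>

lemma eventually_derived:
  "evaluates q as y \<Longrightarrow> prog p = q \<Longrightarrow> list_decode xs = as \<Longrightarrow>
    \<forall>\<^sub>F s in sequentially. derived s \<langle>p, \<langle>xs, y\<rangle>\<rangle> = 1"
proof (induction arbitrary: p xs rule: evaluates.induct)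
  case (Zero as)
  then have "nfst p = 0" by (subst (asm) prog.simps) (simp split: if_splits)
  then show ?case by (intro eventually_derivedI) (simp add: justified_def)
next
  case (Succ x)
  then have "nfst p = 1" by (subst (asm) prog.simps) (simp split: if_splits)
  moreover have "lengthc xs = 1" "nthc xs 0 = x"
    using Succ.prems(2) by (simp_all add: lengthc_eq nthc_eq)
  ultimately show ?case by (intro eventually_derivedI) (simp add: justified_def)
next
  case (Proj i as)
  then have "nfst p = 2 \<and> nsnd p = i"
    by (subst (asm) prog.simps) (simp split: if_splits)
  with Proj show ?case
    by (intro eventually_derivedI) (auto simp: justified_def lengthc_eq nthc_eq)
next
  case (Comp as gs ys f z)
  let ?gs = "nsnd (nsnd p)" and ?ys = "list_encode ys"
  from Comp.prems(1) have p: "nfst p = 3" "prog (nfst (nsnd p)) = f"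
    "map prog (list_decode ?gs) = gs"
    by (subst (asm) prog.simps, simp split: if_splits)+
  have len: "lengthc ?ys = lengthc ?gs"
    using list_all2_lengthD[OF Comp.IH(1)] p(3) by (auto simp: lengthc_eq)
  have "\<forall>i\<in>{..<lengthc ?ys}. \<forall>\<^sub>F s in sequentially.
      derived s \<langle>nthc ?gs i, \<langle>xs, nthc ?ys i\<rangle>\<rangle> = 1"
  proof
    fix i assume i: "i \<in> {..<lengthc ?ys}"
    then have "prog (nthc ?gs i) = gs ! i" "nthc ?ys i = ys ! i" "i < length gs"
      using len by (auto simp: lengthc_eq nthc_eq simp flip: p(3))
    with list_all2_nthD[OF Comp.IH(1), of i] Comp.prems(2)
    show "\<forall>\<^sub>F s in sequentially. derived s \<langle>nthc ?gs i, \<langle>xs, nthc ?ys i\<rangle>\<rangle> = 1"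
      by simp
  qed
  then have "\<forall>\<^sub>F s in sequentially. \<forall>i\<in>{..<lengthc ?ys}.
      derived s \<langle>nthc ?gs i, \<langle>xs, nthc ?ys i\<rangle>\<rangle> = 1"
    by (intro eventually_ball_finite) auto
  moreover have "\<forall>\<^sub>F s in sequentially. derived s \<langle>nfst (nsnd p), \<langle>?ys, z\<rangle>\<rangle> = 1"
    by (rule Comp.IH(2)[OF p(2)]) simp
  ultimately show ?case
    using eventually_gt_at_top[of ?ys]
    by (intro eventually_derivedI, eventually_elim)
      (use p(1) len in \<open>auto simp: justified_def intro!: exI[of _ ?ys]\<close>)
next
  case (Prec_0 f as y g)
  from Prec_0.prems(1) have p: "nfst p = 4" "prog (nfst (nsnd p)) = f"
    by (subst (asm) prog.simps, simp split: if_splits)+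
  have "\<forall>\<^sub>F s in sequentially. derived s \<langle>nfst (nsnd p), \<langle>dropc xs 1, y\<rangle>\<rangle> = 1"
    by (rule Prec_0.IH[OF p(2)]) (simp add: list_decode_dropc Prec_0.prems(2))
  then show ?case
    by (intro eventually_derivedI, elim eventually_mono)
      (simp add: justified_def p(1) lengthc_eq nthc_eq Prec_0.prems(2))
next
  case (Prec_Suc f g n as r y)
  from Prec_Suc.prems(1) have p: "nfst p = 4" "prog (nsnd (nsnd p)) = g"
    by (subst (asm) prog.simps, simp split: if_splits)+
  have "\<forall>\<^sub>F s in sequentially. derived s \<langle>p, \<langle>Suc \<langle>n, dropc xs 1\<rangle>, r\<rangle>\<rangle> = 1"
    by (rule Prec_Suc.IH(1)[OF Prec_Suc.prems(1)])
      (simp add: list_decode_dropc list_decode_Suc_npair Prec_Suc.prems(2))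
  moreover have "\<forall>\<^sub>F s in sequentially.
      derived s \<langle>nsnd (nsnd p), \<langle>Suc \<langle>n, Suc \<langle>r, dropc xs 1\<rangle>\<rangle>, y\<rangle>\<rangle> = 1"
    by (rule Prec_Suc.IH(2)[OF p(2)])
      (simp add: list_decode_dropc list_decode_Suc_npair Prec_Suc.prems(2))
  ultimately show ?case
    using eventually_gt_at_top[of r]
    by (intro eventually_derivedI, eventually_elim)
      (auto simp: justified_def p(1) lengthc_eq nthc_eq Prec_Suc.prems(2))
next
  case (Mu f n as)
  from Mu.prems(1) have p: "nfst p > 4" "prog (nsnd p) = f"
    by (subst (asm) prog.simps, simp split: if_splits)+
  have "\<forall>m\<in>{..<n}. \<forall>\<^sub>F s in sequentially. \<exists>r<s. derived s \<langle>nsnd p, \<langle>Suc \<langle>m, xs\<rangle>, Suc r\<rangle>\<rangle> = 1"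
  proof
    fix m assume "m \<in> {..<n}"
    with Mu.IH(2) obtain r where "\<forall>p xs. prog p = f \<longrightarrow> list_decode xs = m # as \<longrightarrow>
        (\<forall>\<^sub>F s in sequentially. derived s \<langle>p, \<langle>xs, Suc r\<rangle>\<rangle> = 1)"
      by auto
    with p(2) Mu.prems(2) have "\<forall>\<^sub>F s in sequentially. derived s \<langle>nsnd p, \<langle>Suc \<langle>m, xs\<rangle>, Suc r\<rangle>\<rangle> = 1"
      by (simp add: list_decode_Suc_npair)
    then show "\<forall>\<^sub>F s in sequentially. \<exists>r<s. derived s \<langle>nsnd p, \<langle>Suc \<langle>m, xs\<rangle>, Suc r\<rangle>\<rangle> = 1"
      using eventually_gt_at_top[of r] by eventually_elim blast
  qed
  then have "\<forall>\<^sub>F s in sequentially. \<forall>m\<in>{..<n}. \<exists>r<s. derived s \<langle>nsnd p, \<langle>Suc \<langle>m, xs\<rangle>, Suc r\<rangle>\<rangle> = 1"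
    by (intro eventually_ball_finite) auto
  moreover have "\<forall>\<^sub>F s in sequentially. derived s \<langle>nsnd p, \<langle>Suc \<langle>n, xs\<rangle>, 0\<rangle>\<rangle> = 1"
    by (rule Mu.IH(1)[OF p(2)]) (simp add: list_decode_Suc_npair Mu.prems(2))
  ultimately show ?case
    by (intro eventually_derivedI, eventually_elim) (use p(1) in \<open>auto simp: justified_def\<close>)
qed

text \<open>\<open>halts_within e xs y s\<close>: the \<open>e\<close>-th program maps the coded argument list \<open>xs\<close> to \<open>y\<close>, as
  witnessed by stage \<open>s\<close>.\<close>

definition halts_within :: "nat \<Rightarrow> nat \<Rightarrow> nat \<Rightarrow> nat \<Rightarrow> bool" where
  "halts_within e xs y s \<longleftrightarrow> derived s \<langle>e, \<langle>xs, y\<rangle>\<rangle> = 1"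

lemma halts_within_mono: "halts_within e xs y s \<Longrightarrow> s \<le> s' \<Longrightarrow> halts_within e xs y s'"
  unfolding halts_within_def by (rule derived_mono)

lemma ex_halts_within_iff:
  "(\<exists>s. halts_within e xs y s) \<longleftrightarrow> evaluates (prog e) (list_decode xs) y"
proof
  show "\<exists>s. halts_within e xs y s \<Longrightarrow> evaluates (prog e) (list_decode xs) y"
    unfolding halts_within_def using evaluates_if_derived by blast
  assume "evaluates (prog e) (list_decode xs) y"
  from eventually_derived[OF this refl refl] show "\<exists>s. halts_within e xs y s"
    unfolding halts_within_def eventually_sequentially by blast
qed

lemma decidable_halts_within:
  "computable f \<Longrightarrow> computable g \<Longrightarrow> computable h \<Longrightarrow> computable k \<Longrightarrow>
    decidable (\<lambda>x. halts_within (f x) (g x) (h x) (k x))"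
  unfolding halts_within_def by (intro computable_intros computable_derived)

section \<open>Computably enumerable relations\<close>

text \<open>An unbounded search for the witness \<open>s\<close> halts exactly on the related pairs.
  The characteristic function is negated because \<open>Mu\<close> looks for the value 0.\<close>

lemma ce_relI:
  assumes "decidable (\<lambda>z. A (nfst z) (nfst (nsnd z)) (nsnd (nsnd z)))"
    and "\<And>x y. (x, y) \<in> E \<longleftrightarrow> (\<exists>s. A x y s)"
  shows "ce_rel E"
proof -
  have A: "computable (\<lambda>z. if \<not> A (nfst z) (nfst (nsnd z)) (nsnd (nsnd z)) then 1 else 0)"
    by (intro computable_intros assms(1))
  have "computable_n 3 (\<lambda>xs. \<langle>[xs ! 1, \<langle>[xs ! 2, xs ! 0] ! 0, [xs ! 2, xs ! 0] ! 1\<rangle>] ! 0,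
      [xs ! 1, \<langle>[xs ! 2, xs ! 0] ! 0, [xs ! 2, xs ! 0] ! 1\<rangle>] ! 1\<rangle>)"
    by (intro computable_n_comp2[OF computable_n_npair] computable_n_nth) simp_all
  from computable_n_comp1[OF A this]
  have "computable_n 3 (\<lambda>xs. if \<not> A (xs ! 1) (xs ! 2) (xs ! 0) then 1 else 0)"
    by (simp cong: if_cong)
  then obtain p where p: "\<And>xs. length xs = 3 \<Longrightarrow>
      evaluates p xs (if \<not> A (xs ! 1) (xs ! 2) (xs ! 0) then 1 else 0)"
    unfolding computable_n_def by blast
  have p: "evaluates p [s, x, y] (if \<not> A x y s then 1 else 0)" for s x y
    using p[of "[s, x, y]"] by simp
  have "(\<exists>z. evaluates (Mu p) [x, y] z) \<longleftrightarrow> (\<exists>s. A x y s)" for x y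
  proof
    assume "\<exists>z. evaluates (Mu p) [x, y] z"
    then obtain s where "evaluates p [s, x, y] 0" by (auto elim: evaluates_MuE)
    from evaluates_functional[OF this p] show "\<exists>s. A x y s" by (auto split: if_splits)
  next
    assume "\<exists>s. A x y s"
    then have "A x y (LEAST s. A x y s)" by (rule LeastI_ex)
    then have "evaluates (Mu p) [x, y] (LEAST s. A x y s)"
    proof (intro evaluates.Mu allI impI)
      show "evaluates p [LEAST s. A x y s, x, y] 0" if "A x y (LEAST s. A x y s)"
        using p[of "LEAST s. A x y s" x y] that by simp
      fix m assume "m < (LEAST s. A x y s)"
      then have "\<not> A x y m" by (rule not_less_Least)
      then show "\<exists>z. evaluates p [m, x, y] (Suc z)"
        using p[of m x y] by auto
    qed
    then show "\<exists>z. evaluates (Mu p) [x, y] z" ..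
  qed
  then show ?thesis
    unfolding ce_rel_def assms(2) by (intro exI[of _ "Mu p"]) simp
qed

lemma ce_relE:
  assumes "ce_rel E"
  obtains A where "decidable (\<lambda>z. A (nfst z) (nfst (nsnd z)) (nsnd (nsnd z)))"
    and "\<forall>x y s s'. A x y s \<longrightarrow> s \<le> s' \<longrightarrow> A x y s'"
    and "\<forall>x y. (x, y) \<in> E \<longleftrightarrow> (\<exists>s. A x y s)"
proof -
  from assms obtain p where p: "\<And>x y. (x, y) \<in> E \<longleftrightarrow> (\<exists>z. evaluates p [x, y] z)"
    unfolding ce_rel_def by blast
  obtain e where "prog e = p" using prog_surj by blast
  with p have e: "(x, y) \<in> E \<longleftrightarrow> (\<exists>z. evaluates (prog e) [x, y] z)" for x y by simp
  \<comment> \<open>Bounding the output by the stage keeps the approximation decidable and makes it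
    increasing in \<open>s\<close>.\<close>
  define A where "A x y s \<longleftrightarrow> (\<exists>z<s. halts_within e (Suc \<langle>x, Suc \<langle>y, 0\<rangle>\<rangle>) z s)" for x y s
  show thesis
  proof
    show "decidable (\<lambda>z. A (nfst z) (nfst (nsnd z)) (nsnd (nsnd z)))"
      unfolding A_def by (intro computable_intros decidable_halts_within)
    show "\<forall>x y s s'. A x y s \<longrightarrow> s \<le> s' \<longrightarrow> A x y s'"
      unfolding A_def using halts_within_mono less_le_trans by blast
    have "evaluates (prog e) [x, y] z \<longleftrightarrow> (\<exists>s. halts_within e (Suc \<langle>x, Suc \<langle>y, 0\<rangle>\<rangle>) z s)" for x y z
      by (simp add: ex_halts_within_iff list_decode_Suc_npair)
    moreover have "(\<exists>z s. halts_within e xs z s) \<longleftrightarrow> (\<exists>s. \<exists>z<s. halts_within e xs z s)" for xs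
    proof
      assume "\<exists>z s. halts_within e xs z s"
      then obtain z s where "halts_within e xs z s" by blast
      then have "halts_within e xs z (s + Suc z)" by (rule halts_within_mono) simp
      then show "\<exists>s. \<exists>z<s. halts_within e xs z s" by (intro exI[of _ "s + Suc z"] exI[of _ z]) simp
    qed blast
    ultimately show "\<forall>x y. (x, y) \<in> E \<longleftrightarrow> (\<exists>s. A x y s)"
      by (simp only: e A_def) simp
  qed
qed

text \<open>Values and their witnesses are searched for together, as one number, so that the search
  is total. This is how representatives are found and reductions inverted.\<close>

lemma computable_choice:
  assumes "ce_rel E" "\<And>x. \<exists>y. (x, y) \<in> E"
  shows "\<exists>f. computable f \<and> (\<forall>x. (x, f x) \<in> E)"
proof -
  from assms(1) obtain A where A: "decidable (\<lambda>z. A (nfst z) (nfst (nsnd z)) (nsnd (nsnd z)))"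
    and E: "\<forall>x y. (x, y) \<in> E \<longleftrightarrow> (\<exists>s. A x y s)"
    by (rule ce_relE)
  have ex: "\<exists>w. A x (nfst w) (nsnd w)" for x
  proof -
    from assms(2)[of x] E obtain y s where "A x y s" by blast
    then show ?thesis by (intro exI[of _ "\<langle>y, s\<rangle>"]) simp
  qed
  have "computable (\<lambda>x. LEAST w. A x (nfst w) (nsnd w))"
    by (rule computable_Least[where P = "\<lambda>x w. A x (nfst w) (nsnd w)", OF A ex])
  then have "computable (\<lambda>x. nfst (LEAST w. A x (nfst w) (nsnd w)))"
    by (rule computable_nfst)
  moreover have "(x, nfst (LEAST w. A x (nfst w) (nsnd w))) \<in> E" for x
    using LeastI_ex[OF ex[of x]] E by blast
  ultimately show ?thesis by blast
qed

section \<open>Reductions between ceers\<close>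

lemma ceerD:
  assumes "ceer E"
  shows "(x, x) \<in> E" "(x, y) \<in> E \<Longrightarrow> (y, x) \<in> E" "(x, y) \<in> E \<Longrightarrow> (y, z) \<in> E \<Longrightarrow> (x, z) \<in> E"
  using assms unfolding ceer_def
  by (auto simp: equiv_def refl_on_def dest: symD transD)

lemma ceerI:
  assumes "ce_rel E" "\<And>x. (x, x) \<in> E" "\<And>x y. (x, y) \<in> E \<Longrightarrow> (y, x) \<in> E"
    "\<And>x y z. (x, y) \<in> E \<Longrightarrow> (y, z) \<in> E \<Longrightarrow> (x, z) \<in> E"
  shows "ceer E"
proof -
  have "equiv UNIV E"
    by (rule equivI[OF _ refl_onI symI transI])
      (simp, rule assms(2), erule assms(3), erule (1) assms(4))
  with assms(1) show ?thesis by (simp add: ceer_def)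
qed

lemma reducible_trans:
  assumes "E \<le>\<^sub>c R" "R \<le>\<^sub>c S"
  shows "E \<le>\<^sub>c S"
proof -
  from assms obtain f g where "computable f" "\<forall>x y. (x, y) \<in> E \<longleftrightarrow> (f x, f y) \<in> R"
    "computable g" "\<forall>x y. (x, y) \<in> R \<longleftrightarrow> (g x, g y) \<in> S"
    unfolding reducible_def by blast
  then show ?thesis
    unfolding reducible_def by (intro exI[of _ "\<lambda>x. g (f x)"]) (simp add: computable_compose)
qed

text \<open>The sequence \<open>g\<close> need not be computable; a computable one would reduce
  \<open>Id\<close> to \<open>E\<close>.\<close>

lemma infinite_classes_iff:
  assumes "equiv UNIV E"
  shows "infinite (UNIV // E) \<longleftrightarrow> (\<exists>g::nat \<Rightarrow> nat. \<forall>i j. i \<noteq> j \<longrightarrow> (g i, g j) \<notin> E)"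
proof
  assume "infinite (UNIV // E)"
  then obtain C :: "nat \<Rightarrow> nat set" where C: "inj C" "range C \<subseteq> UNIV // E"
    using infinite_countable_subset by blast
  have "\<exists>x. C i = E `` {x}" for i
    using C(2) by (auto simp: quotient_def)
  then obtain g where g: "\<And>i. C i = E `` {g i}" by metis
  have "(g i, g j) \<notin> E" if "i \<noteq> j" for i j
    using equiv_class_eq[OF assms] injD[OF C(1), of i j] g that by metis
  then show "\<exists>g::nat \<Rightarrow> nat. \<forall>i j. i \<noteq> j \<longrightarrow> (g i, g j) \<notin> E" by blast
next
  assume "\<exists>g::nat \<Rightarrow> nat. \<forall>i j. i \<noteq> j \<longrightarrow> (g i, g j) \<notin> E"
  then obtain g :: "nat \<Rightarrow> nat" where g: "\<And>i j. i \<noteq> j \<Longrightarrow> (g i, g j) \<notin> E" by blast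
  have "inj (\<lambda>i. E `` {g i})"
  proof (rule injI)
    fix i j assume "E `` {g i} = E `` {g j}"
    then have "(g i, g j) \<in> E" using eq_equiv_class[OF _ assms] by simp
    then show "i = j" using g by blast
  qed
  moreover have "range (\<lambda>i. E `` {g i}) \<subseteq> UNIV // E" by (auto intro: quotientI)
  ultimately show "infinite (UNIV // E)" using infinite_iff_countable_subset by blast
qed

lemma infinite_classes_reducible:
  assumes "equiv UNIV E" "equiv UNIV R" "E \<le>\<^sub>c R" "infinite (UNIV // E)"
  shows "infinite (UNIV // R)"
proof -
  obtain g :: "nat \<Rightarrow> nat" where g: "\<And>i j. i \<noteq> j \<Longrightarrow> (g i, g j) \<notin> E"
    using assms(4) unfolding infinite_classes_iff[OF assms(1)] by blast
  obtain f where f: "\<And>x y. (x, y) \<in> E \<longleftrightarrow> (f x, f y) \<in> R"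
    using assms(3) unfolding reducible_def by blast
  have "\<forall>i j. i \<noteq> j \<longrightarrow> (f (g i), f (g j)) \<notin> R"
    using f g by blast
  then show ?thesis
    unfolding infinite_classes_iff[OF assms(2)] by (intro exI[of _ "\<lambda>i. f (g i)"])
qed

lemma finite_classes_representatives:
  fixes X :: "nat rel"
  assumes "equiv UNIV X" "finite (UNIV // X)"
  obtains n :: nat and r :: "nat \<Rightarrow> nat"
  where "1 \<le> n" "\<forall>x. \<exists>i<n. (x, r i) \<in> X"
    "\<forall>i<n. \<forall>j<n. (r i, r j) \<in> X \<longrightarrow> i = j"
proof -
  obtain h where h: "bij_betw h {0..<card (UNIV // X)} (UNIV // X)"
    using ex_bij_betw_nat_finite[OF assms(2)] by blast
  let ?n = "card (UNIV // X)"
  have "\<exists>x. h i = X `` {x}" if "i < ?n" for i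
    using bij_betw_apply[OF h, of i] that by (auto simp: quotient_def)
  then obtain r where r: "\<And>i. i < ?n \<Longrightarrow> h i = X `` {r i}" by metis
  show thesis
  proof
    have "UNIV // X \<noteq> {}" by (auto simp: quotient_def)
    then show "1 \<le> ?n" using assms(2) by (simp add: Suc_le_eq card_gt_0_iff)
    show "\<forall>x. \<exists>i<?n. (x, r i) \<in> X"
    proof
      fix x
      have "X `` {x} \<in> h ` {0..<?n}"
        using h by (auto simp: bij_betw_def intro: quotientI)
      then obtain i where i: "i < ?n" "X `` {x} = h i" by auto
      then have "X `` {x} = X `` {r i}" using r by simp
      then have "(x, r i) \<in> X" using eq_equiv_class[OF _ assms(1)] by simp
      with i(1) show "\<exists>i<?n. (x, r i) \<in> X" by blast
    qed
    have "i = j" if ij: "i < ?n" "j < ?n" "(r i, r j) \<in> X" for i j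
    proof -
      have "h i = h j" using equiv_class_eq[OF assms(1) ij(3)] r ij by simp
      then show ?thesis
        using h ij unfolding bij_betw_def inj_on_def by simp
    qed
    then show "\<forall>i<?n. \<forall>j<?n. (r i, r j) \<in> X \<longrightarrow> i = j" by blast
  qed
qed

text \<open>Finitely many values of an arbitrary \<open>r\<close> can be written into a
  program.\<close>

lemma computable_finite: "computable (\<lambda>i. if i < n then r i else 0)"
proof (induction n)
  case (Suc n)
  have "computable (\<lambda>i. if i = n then r n else if i < n then r i else 0)"
    by (intro computable_intros Suc)
  then show ?case
    by (rule back_subst[of computable]) (auto simp: less_Suc_eq)
qed (simp add: computable_const)

text \<open>Each number is equivalent to exactly one of the listed representatives, and enumerating
  \<open>X\<close> reveals which one; its position then selects one of the inequivalent points of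
  \<open>Y\<close>.\<close>

lemma finite_classes_reducible:
  fixes r y :: "nat \<Rightarrow> nat"
  assumes "ceer X" and Y: "\<And>i j. i < n \<Longrightarrow> j < n \<Longrightarrow> (y i, y j) \<in> Y \<Longrightarrow> i = j" "\<And>i. (y i, y i) \<in> Y"
    and r: "\<forall>x. \<exists>i<n. (x, r i) \<in> X" "\<forall>i<n. \<forall>j<n. (r i, r j) \<in> X \<longrightarrow> i = j"
  shows "X \<le>\<^sub>c Y"
proof -
  note X = ceerD[OF assms(1)]
  have "ce_rel X" using assms(1) by (simp add: ceer_def)
  then obtain A where A: "decidable (\<lambda>z. A (nfst z) (nfst (nsnd z)) (nsnd (nsnd z)))"
    and X_A: "\<forall>x y. (x, y) \<in> X \<longleftrightarrow> (\<exists>s. A x y s)"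
    by (rule ce_relE)
  let ?r = "\<lambda>i. if i < n then r i else 0"
  have "ce_rel {(x, i). i < n \<and> (x, ?r i) \<in> X}"
    by (rule ce_relI[where A = "\<lambda>x i s. i < n \<and> A x (?r i) s"])
      (intro computable_intros decidable_compose3[of A, OF A]
        computable_compose[OF computable_finite], simp add: X_A)
  moreover have "\<exists>i. (x, i) \<in> {(x, i). i < n \<and> (x, ?r i) \<in> X}" for x
    using r(1) by auto
  ultimately obtain f where f: "computable f" "\<And>x. (x, f x) \<in> {(x, i). i < n \<and> (x, ?r i) \<in> X}"
    using computable_choice by blast
  have f': "f x < n" "(x, r (f x)) \<in> X" for x
    using f(2)[of x] by auto
  let ?y = "\<lambda>i. if i < n then y i else 0"
  have "computable (\<lambda>x. ?y (f x))"
    by (rule computable_compose[OF computable_finite f(1)])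
  moreover have "(x, x') \<in> X \<longleftrightarrow> (?y (f x), ?y (f x')) \<in> Y" for x x'
  proof
    assume "(x, x') \<in> X"
    then have "(r (f x), r (f x')) \<in> X"
      using X(3)[OF X(2)[OF f'(2)] X(3)[OF _ f'(2)]] by blast
    then have "f x = f x'" using r(2) f'(1) by blast
    then show "(?y (f x), ?y (f x')) \<in> Y" using Y(2) f'(1) by simp
  next
    assume "(?y (f x), ?y (f x')) \<in> Y"
    then have "f x = f x'" using Y(1) f'(1) by simp
    then have "(r (f x), x') \<in> X" using X(2)[OF f'(2)[of x']] by simp
    with f'(2)[of x] show "(x, x') \<in> X" by (rule X(3))
  qed
  ultimately show ?thesis unfolding reducible_def by blast
qed

lemma finite_classes_reducible_Id_mod:
  assumes "ceer X" "finite (UNIV // X)"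
  shows "\<exists>n\<ge>1. X \<le>\<^sub>c Id_mod n"
proof -
  have "equiv UNIV X" using assms(1) by (simp add: ceer_def)
  then obtain n :: nat and r where n: "1 \<le> n" and r: "\<forall>x. \<exists>i<n. (x, r i) \<in> X"
    "\<forall>i<n. \<forall>j<n. (r i, r j) \<in> X \<longrightarrow> i = j"
    using assms(2) by (rule finite_classes_representatives)
  have "X \<le>\<^sub>c Id_mod n"
    using assms(1) _ _ r
    by (rule finite_classes_reducible[where y = "\<lambda>i. i"]) (simp_all add: Id_mod_def)
  with n show ?thesis by blast
qed

lemma finite_classes_reducible_infinite:
  assumes "ceer X" "finite (UNIV // X)" "ceer R" "infinite (UNIV // R)"
  shows "X \<le>\<^sub>c R"
proof -
  have eq: "equiv UNIV X" "equiv UNIV R" using assms by (simp_all add: ceer_def)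
  obtain n :: nat and r where r: "\<forall>x. \<exists>i<n. (x, r i) \<in> X"
    "\<forall>i<n. \<forall>j<n. (r i, r j) \<in> X \<longrightarrow> i = j"
    by (rule finite_classes_representatives[OF eq(1) assms(2)])
  obtain g :: "nat \<Rightarrow> nat" where g: "\<And>i j. i \<noteq> j \<Longrightarrow> (g i, g j) \<notin> R"
    using assms(4) unfolding infinite_classes_iff[OF eq(2)] by blast
  show ?thesis
    using assms(1) _ _ r
    by (rule finite_classes_reducible[where y = g]) (use g ceerD(1)[OF assms(3)] in blast)+
qed

text \<open>The disjoint sum. All nonzero tags name the same copy of \<open>E\<close>, so every
  number belongs to one of the two sides.\<close>

definition join :: "nat rel \<Rightarrow> nat rel \<Rightarrow> nat rel" where
  "join R E = {(x, y). nfst x = 0 \<and> nfst y = 0 \<and> (nsnd x, nsnd y) \<in> R \<or>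
    nfst x \<noteq> 0 \<and> nfst y \<noteq> 0 \<and> (nsnd x, nsnd y) \<in> E}"

lemma ceer_join:
  assumes "ceer R" "ceer E"
  shows "ceer (join R E)"
proof (rule ceerI)
  have "ce_rel R" "ce_rel E" using assms by (simp_all add: ceer_def)
  then obtain A B where A: "decidable (\<lambda>z. A (nfst z) (nfst (nsnd z)) (nsnd (nsnd z)))"
    "\<forall>x y. (x, y) \<in> R \<longleftrightarrow> (\<exists>s. A x y s)"
    and B: "decidable (\<lambda>z. B (nfst z) (nfst (nsnd z)) (nsnd (nsnd z)))"
    "\<forall>x y. (x, y) \<in> E \<longleftrightarrow> (\<exists>s. B x y s)"
    by (elim ce_relE) blast
  show "ce_rel (join R E)"
    by (rule ce_relI[where A = "\<lambda>x y s. nfst x = 0 \<and> nfst y = 0 \<and> A (nsnd x) (nsnd y) s \<or>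
        nfst x \<noteq> 0 \<and> nfst y \<noteq> 0 \<and> B (nsnd x) (nsnd y) s"])
      (intro computable_intros decidable_compose3[of A, OF A(1)] decidable_compose3[of B, OF B(1)],
        auto simp: join_def A(2) B(2))
  fix x y z
  show "(x, x) \<in> join R E"
    by (auto simp: join_def ceerD(1)[OF assms(1)] ceerD(1)[OF assms(2)])
  show "(x, y) \<in> join R E \<Longrightarrow> (y, x) \<in> join R E"
    using ceerD(2)[OF assms(1), of "nsnd x" "nsnd y"] ceerD(2)[OF assms(2), of "nsnd x" "nsnd y"]
    by (auto simp: join_def)
  show "(x, y) \<in> join R E \<Longrightarrow> (y, z) \<in> join R E \<Longrightarrow> (x, z) \<in> join R E"
    using ceerD(3)[OF assms(1), of "nsnd x" "nsnd y" "nsnd z"]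
      ceerD(3)[OF assms(2), of "nsnd x" "nsnd y" "nsnd z"]
    by (auto simp: join_def)
qed

lemma reducible_join_left: "R \<le>\<^sub>c join R E"
  unfolding reducible_def
  by (intro exI[of _ "\<lambda>x. \<langle>0, x\<rangle>"] conjI computable_intros) (simp add: join_def)

lemma reducible_join_right: "E \<le>\<^sub>c join R E"
  unfolding reducible_def
  by (intro exI[of _ "\<lambda>x. \<langle>1, x\<rangle>"] conjI computable_intros) (simp add: join_def)

definition copies :: "nat rel \<Rightarrow> nat rel" where
  "copies V = {(x, y). nsnd x = nsnd y \<and> (nfst x, nfst y) \<in> V}"

lemma ceer_copies:
  assumes "ceer V"
  shows "ceer (copies V)"
proof (rule ceerI)
  have "ce_rel V" using assms by (simp add: ceer_def)
  then obtain A where A: "decidable (\<lambda>z. A (nfst z) (nfst (nsnd z)) (nsnd (nsnd z)))"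
    "\<forall>x y. (x, y) \<in> V \<longleftrightarrow> (\<exists>s. A x y s)"
    by (rule ce_relE)
  show "ce_rel (copies V)"
    by (rule ce_relI[where A = "\<lambda>x y s. nsnd x = nsnd y \<and> A (nfst x) (nfst y) s"])
      (intro computable_intros decidable_compose3[of A, OF A(1)], simp add: copies_def A(2))
  fix x y z
  show "(x, x) \<in> copies V"
    by (simp add: copies_def ceerD(1)[OF assms])
  show "(x, y) \<in> copies V \<Longrightarrow> (y, x) \<in> copies V"
    using ceerD(2)[OF assms, of "nfst x" "nfst y"] by (auto simp: copies_def)
  show "(x, y) \<in> copies V \<Longrightarrow> (y, z) \<in> copies V \<Longrightarrow> (x, z) \<in> copies V"
    using ceerD(3)[OF assms, of "nfst x" "nfst y" "nfst z"] by (auto simp: copies_def)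
qed

text \<open>Reduce infinitely many disjoint copies of a given ceer to \<open>join R E\<close>. Either one copy is
  mapped into \<open>R\<close>, or picking from each copy an element mapped into \<open>E\<close> reduces \<^term>\<open>Id\<close> to \<open>E\<close>.\<close>

lemma not_universal_join:
  assumes "ceer R" "\<not> universal R" "dark E"
  shows "\<not> universal (join R E)"
proof
  assume univ: "universal (join R E)"
  obtain V where V: "ceer V" "\<not> V \<le>\<^sub>c R"
    using assms(1,2) unfolding universal_def by blast
  obtain f where f: "computable f" "\<And>x y. (x, y) \<in> copies V \<longleftrightarrow> (f x, f y) \<in> join R E"
    using univ ceer_copies[OF V(1)] unfolding universal_def reducible_def by metis
  show False
  proof (cases "\<exists>k. \<forall>x. nfst (f \<langle>x, k\<rangle>) = 0")
    case True
    then obtain k where k: "\<And>x. nfst (f \<langle>x, k\<rangle>) = 0" by blast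
    have "(x, y) \<in> V \<longleftrightarrow> (nsnd (f \<langle>x, k\<rangle>), nsnd (f \<langle>y, k\<rangle>)) \<in> R" for x y
      using f(2)[of "\<langle>x, k\<rangle>" "\<langle>y, k\<rangle>"] k by (simp add: copies_def join_def)
    moreover have "computable (\<lambda>x. nsnd (f \<langle>x, k\<rangle>))"
      by (intro computable_intros computable_compose[OF f(1)])
    ultimately show False using V(2) unfolding reducible_def by blast
  next
    case False
    then have ex: "\<exists>x. nfst (f \<langle>x, k\<rangle>) \<noteq> 0" for k by blast
    define g where "g k = (LEAST x. nfst (f \<langle>x, k\<rangle>) \<noteq> 0)" for k
    have g: "nfst (f \<langle>g k, k\<rangle>) \<noteq> 0" for k
      unfolding g_def using ex by (rule LeastI_ex)
    have "computable g"
      unfolding g_def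
      by (intro computable_Least computable_intros computable_compose[OF f(1)] ex)
    then have "computable (\<lambda>k. nsnd (f \<langle>g k, k\<rangle>))"
      by (intro computable_intros computable_compose[OF f(1)])
    moreover have "(k, l) \<in> Id \<longleftrightarrow> (nsnd (f \<langle>g k, k\<rangle>), nsnd (f \<langle>g l, l\<rangle>)) \<in> E" for k l
      using f(2)[of "\<langle>g k, k\<rangle>" "\<langle>g l, l\<rangle>"] g ceerD(1)[OF V(1)]
      by (auto simp: copies_def join_def)
    ultimately have "Id \<le>\<^sub>c E" unfolding reducible_def by blast
    then show False using assms(3) by (simp add: dark_def)
  qed
qed

lemma ceer_Id: "ceer Id"
proof (rule ceerI)
  show "ce_rel Id"
    by (rule ce_relI[where A = "\<lambda>x y s. x = y"]) (intro computable_intros, simp)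
qed auto

text \<open>The diagonal halting set, collapsed to one class, is a ceer that is not decidable.\<close>

lemma not_universal_Id: "\<not> universal Id"
proof
  assume univ: "universal Id"
  define H where "H e \<longleftrightarrow> evaluates (prog e) [e] 0" for e
  define V where "V = {(x, y). x = y \<or> H x \<and> H y}"
  have H_eq: "H e \<longleftrightarrow> (\<exists>s. halts_within e (Suc \<langle>e, 0\<rangle>) 0 s)" for e
    by (simp add: H_def ex_halts_within_iff list_decode_Suc_npair)
  have "ceer V"
  proof (rule ceerI)
    show "ce_rel V"
    proof (rule ce_relI[where A = "\<lambda>x y s. x = y \<or> halts_within x (Suc \<langle>x, 0\<rangle>) 0 s \<and>
          halts_within y (Suc \<langle>y, 0\<rangle>) 0 s"])
      show "(x, y) \<in> V \<longleftrightarrow> (\<exists>s. x = y \<or> halts_within x (Suc \<langle>x, 0\<rangle>) 0 s \<and>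
          halts_within y (Suc \<langle>y, 0\<rangle>) 0 s)" for x y
      proof
        assume "(x, y) \<in> V"
        then consider "x = y" | s s' where "halts_within x (Suc \<langle>x, 0\<rangle>) 0 s"
          "halts_within y (Suc \<langle>y, 0\<rangle>) 0 s'"
          by (auto simp: V_def H_eq)
        then show "\<exists>s. x = y \<or> halts_within x (Suc \<langle>x, 0\<rangle>) 0 s \<and>
            halts_within y (Suc \<langle>y, 0\<rangle>) 0 s"
        proof cases
          case (2 s s')
          then have "halts_within x (Suc \<langle>x, 0\<rangle>) 0 (max s s')" "halts_within y (Suc \<langle>y, 0\<rangle>) 0 (max s s')"
            by (auto elim: halts_within_mono)
          then show ?thesis by blast
        qed blast
      qed (auto simp: V_def H_eq)
    qed (intro computable_intros decidable_halts_within)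
  qed (auto simp: V_def)
  then obtain f where f: "computable f" "\<And>x y. (x, y) \<in> V \<longleftrightarrow> f x = f y"
    using univ unfolding universal_def reducible_def by auto
  have prog_computable: "\<exists>e. \<forall>x. evaluates (prog e) [x] (h x)" if "computable h" for h
    using that prog_surj unfolding computable_def by metis
  obtain e0 where "\<forall>x. evaluates (prog e0) [x] 0"
    using prog_computable[OF computable_const] by blast
  then have "H e0" by (simp add: H_def)
  then have H: "H x \<longleftrightarrow> f x = f e0" for x
    using f(2)[of x e0] by (auto simp: V_def)
  \<comment> \<open>Diagonalization: a reduction of \<open>V\<close> to \<open>Id\<close> decides
    \<open>H\<close>, and a program \<open>e\<close> deciding it outputs 0 on \<open>e\<close>
    exactly if \<open>e\<close> is not in \<open>H\<close>.\<close>
  have "computable (\<lambda>x. if f x = f e0 then 1 else 0)"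
    by (intro computable_intros f(1))
  then obtain e where "\<forall>x. evaluates (prog e) [x] (if f x = f e0 then 1 else 0)"
    using prog_computable by blast
  then have "evaluates (prog e) [e] (if H e then 1 else 0)" by (simp add: H)
  then show False
    using evaluates_functional[of "prog e" "[e]" "if H e then 1 else 0" 0]
    by (auto simp: H_def split: if_splits)
qed

section \<open>The construction\<close>

definition outputs :: "nat \<Rightarrow> nat \<Rightarrow> nat \<Rightarrow> nat \<Rightarrow> bool" where
  "outputs i u v s \<longleftrightarrow> halts_within i (Suc \<langle>u, 0\<rangle>) v s"

text \<open>Stage \<open>s\<close> works for requirement \<open>req s\<close>. A stage of kind 0 tests whether the program numbered
  \<open>req s\<close> has so far behaved like a reduction of \<open>E\<close> to \<open>R\<close>. If so, the stage goes live: the number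
  \<open>s\<close> becomes a location at which \<open>U\<close> is coded, and requirements of lower priority may no longer
  change the classes of the numbers \<open>\<le> s\<close>. Kind 1 merges two coding locations of \<open>req s\<close>. Kind 2,
  for \<open>req s = \<langle>i, x\<rangle>\<close>, merges a value of the \<open>i\<close>-th program into the class of \<open>x\<close>. The last component
  of a stage is ignored, so that every task recurs infinitely often.\<close>

definition req :: "nat \<Rightarrow> nat" where "req s = nfst (nfst s)"
definition kind :: "nat \<Rightarrow> nat" where "kind s = nfst (nsnd (nfst s))"
definition source :: "nat \<Rightarrow> nat" where "source s = nsnd (nsnd (nsnd (nfst s)))"
definition target :: "nat \<Rightarrow> nat" where
  "target s = (if kind s = 1 then nfst (nsnd (nsnd (nfst s))) else nsnd (req s))"

definition stage :: "nat \<Rightarrow> nat \<Rightarrow> nat \<Rightarrow> nat \<Rightarrow> nat \<Rightarrow> nat" where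
  "stage n k a b N = \<langle>\<langle>n, \<langle>k, \<langle>a, b\<rangle>\<rangle>\<rangle>, N\<rangle>"

text \<open>In the next definitions \<open>h\<close> stands for the table of stage \<open>s\<close>: the entry \<open>h z\<close> is the pair of
  the representative of \<open>z\<close> and a flag telling whether stage \<open>z\<close> was live. Numbers \<open>\<ge> s\<close> are their
  own representatives.\<close>

definition rep :: "nat \<Rightarrow> (nat \<Rightarrow> nat) \<Rightarrow> nat \<Rightarrow> nat" where
  "rep s h z = (if z < s then nfst (h z) else z)"

definition unrestrained :: "nat \<Rightarrow> (nat \<Rightarrow> nat) \<Rightarrow> bool" where
  "unrestrained s h \<longleftrightarrow> (\<forall>t<s. nsnd (h t) \<noteq> 0 \<and> req t < req s \<longrightarrow>
    (\<forall>z<Suc t. rep s h z \<noteq> rep s h (source s)))"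

text \<open>A location whose index is \<open>\<langle>x, k\<rangle>\<close> codes the element \<open>x\<close> in the \<open>k\<close>-th copy of \<open>U\<close>. Infinitely many
  copies are coded because merges of higher priority may spoil finitely many of them.\<close>

definition location_index :: "(nat \<Rightarrow> nat) \<Rightarrow> nat \<Rightarrow> nat \<Rightarrow> nat" where
  "location_index h n t = card {t'. t' < t \<and> (nsnd (h t') \<noteq> 0 \<and> req t' = n)}"

lemma outputs_mono: "outputs i u v s \<Longrightarrow> s \<le> s' \<Longrightarrow> outputs i u v s'"
  unfolding outputs_def by (rule halts_within_mono)

lemma ex_outputs_iff: "(\<exists>s. outputs i u v s) \<longleftrightarrow> evaluates (prog i) [u] v"
  unfolding outputs_def ex_halts_within_iff by (simp add: list_decode_Suc_npair)

lemma stage_simps [simp]: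
  "req (stage n k a b N) = n" "kind (stage n k a b N) = k" "source (stage n k a b N) = b"
  "target (stage n k a b N) = (if k = 1 then a else nsnd n)"
  by (simp_all add: req_def kind_def source_def target_def stage_def)

lemma stage_ge: "N \<le> stage n k a b N"
  by (simp add: stage_def le_npair_2)

lemma computable_req: "computable f \<Longrightarrow> computable (\<lambda>x. req (f x))"
  and computable_kind: "computable f \<Longrightarrow> computable (\<lambda>x. kind (f x))"
  and computable_source: "computable f \<Longrightarrow> computable (\<lambda>x. source (f x))"
  unfolding req_def kind_def source_def by (intro computable_intros; assumption)+

lemma computable_target: "computable f \<Longrightarrow> computable (\<lambda>x. target (f x))"
  unfolding target_def by (intro computable_intros computable_kind computable_req)

lemma decidable_outputs:
  "computable f \<Longrightarrow> computable g \<Longrightarrow> computable h \<Longrightarrow> computable k \<Longrightarrow>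
    decidable (\<lambda>x. outputs (f x) (g x) (h x) (k x))"
  unfolding outputs_def by (intro decidable_halts_within computable_intros)

locale priority =
  fixes R U :: "nat rel" and r u :: "nat \<Rightarrow> nat \<Rightarrow> nat \<Rightarrow> bool"
  assumes ceer_R: "ceer R" and ceer_U: "ceer U"
    and decidable_r: "decidable (\<lambda>z. r (nfst z) (nfst (nsnd z)) (nsnd (nsnd z)))"
    and r_mono: "r x y s \<Longrightarrow> s \<le> s' \<Longrightarrow> r x y s'"
    and R_iff: "(x, y) \<in> R \<longleftrightarrow> (\<exists>s. r x y s)"
    and decidable_u: "decidable (\<lambda>z. u (nfst z) (nfst (nsnd z)) (nsnd (nsnd z)))"
    and u_mono: "u x y s \<Longrightarrow> s \<le> s' \<Longrightarrow> u x y s'"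
    and U_iff: "(x, y) \<in> U \<longleftrightarrow> (\<exists>s. u x y s)"
begin

text \<open>The test covers the initial segments up to all earlier live stages of the same
  requirement, so each pass lengthens the next test. The first stage of kind 0 of a requirement
  passes vacuously.\<close>

definition goes_live :: "nat \<Rightarrow> (nat \<Rightarrow> nat) \<Rightarrow> bool" where
  "goes_live s h \<longleftrightarrow> kind s = 0 \<and> (\<forall>t<s. nsnd (h t) \<noteq> 0 \<and> req t = req s \<longrightarrow>
    (\<forall>x<Suc t. \<forall>x'<Suc t. \<exists>v<s. \<exists>v'<s. outputs (req s) x v s \<and> outputs (req s) x' v' s \<and>
      (rep s h x = rep s h x' \<longleftrightarrow> r v v' s)))"

text \<open>Only the source is subject to restraint, because the target class keeps its
  representative: no restrained number changes its representative. The negated conjunct stops a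
  range requirement as soon as some value is in the class of the target.\<close>

definition merges :: "nat \<Rightarrow> (nat \<Rightarrow> nat) \<Rightarrow> bool" where
  "merges s h \<longleftrightarrow> target s < s \<and> source s < s \<and> rep s h (target s) \<noteq> rep s h (source s) \<and>
    unrestrained s h \<and>
    (kind s = 1 \<and> nsnd (h (target s)) \<noteq> 0 \<and> nsnd (h (source s)) \<noteq> 0 \<and>
       req (target s) = req s \<and> req (source s) = req s \<and>
       nsnd (location_index h (req s) (target s)) = nsnd (location_index h (req s) (source s)) \<and>
       u (nfst (location_index h (req s) (target s))) (nfst (location_index h (req s) (source s))) s \<or>
     kind s = 2 \<and> (\<exists>v<s. outputs (nfst (req s)) v (source s) s) \<and>
       \<not> (\<exists>v<s. \<exists>z<s. outputs (nfst (req s)) v z s \<and> rep s h z = rep s h (target s)))"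

definition next_entry :: "nat \<Rightarrow> (nat \<Rightarrow> nat) \<Rightarrow> nat \<Rightarrow> nat" where
  "next_entry s h z =
    \<langle>if merges s h \<and> rep s h z = rep s h (source s) then rep s h (target s) else rep s h z,
     if z = s then (if goes_live s h then 1 else 0) else nsnd (h z)\<rangle>"

fun state :: "nat \<Rightarrow> nat \<Rightarrow> nat" where
  "state 0 z = 0"
| "state (Suc s) z = (if z \<le> s then next_entry s (state s) z else 0)"

declare state.simps [simp del]

text \<open>All quantifiers in the definitions of a stage are bounded, so a stage is computable from
  the table of the previous one.\<close>

lemma computable_state:
  "computable f \<Longrightarrow> computable g \<Longrightarrow> computable (\<lambda>x. state (f x) (g x))"
proof -
  have "computable (\<lambda>z. state (nfst z) (nsnd z))"
  proof (rule computable_table_rec[where G = next_entry])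
    fix h assume h: "computable (\<lambda>z. h (nfst z) (nsnd z))"
    note [computable_intros] = computable_compose2[of h, OF h] computable_req computable_kind
      computable_source computable_target decidable_outputs
      decidable_compose3[of r, OF decidable_r] decidable_compose3[of u, OF decidable_u]
    have rep: "computable (\<lambda>x. rep (f x) (h (g x)) (k x))"
      if "computable f" "computable g" "computable k" for f g k
      unfolding rep_def by (intro computable_intros that)
    have index: "computable (\<lambda>x. location_index (h (f x)) (g x) (k x))"
      if "computable f" "computable g" "computable k" for f g k
      unfolding location_index_def
      by (intro computable_intros that computable_compose[OF that(1)] computable_compose[OF that(2)])
    note [computable_intros] = rep index
    have "decidable (\<lambda>x. merges (nfst x) (h x))"
      unfolding merges_def unrestrained_def by (intro computable_intros)
    moreover have "decidable (\<lambda>x. goes_live (nfst x) (h x))"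
      unfolding goes_live_def by (intro computable_intros)
    ultimately show "computable (\<lambda>w. next_entry (nfst w) (h w) (nsnd (nsnd w)))"
      unfolding next_entry_def by (intro computable_intros)
  qed (simp_all add: state.simps)
  then show "computable f \<Longrightarrow> computable g \<Longrightarrow> computable (\<lambda>x. state (f x) (g x))"
    by (rule computable_compose2[of state])
qed

section \<open>Representatives and the limit relation\<close>

definition rp :: "nat \<Rightarrow> nat \<Rightarrow> nat" where
  "rp s = rep s (state s)"

definition Live :: "nat set" where
  "Live = {t. goes_live t (state t)}"

definition index :: "nat \<Rightarrow> nat" where
  "index t = card {t'. t' < t \<and> (t' \<in> Live \<and> req t' = req t)}"

definition merging :: "nat \<Rightarrow> bool" where
  "merging s \<longleftrightarrow> merges s (state s)"

definition E :: "nat rel" where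
  "E = {(x, y). \<exists>s. rp s x = rp s y}"

text \<open>A flag is written once, at its own stage, and only copied afterwards.\<close>

lemma state_live_iff: "t < s \<Longrightarrow> nsnd (state s t) \<noteq> 0 \<longleftrightarrow> t \<in> Live"
proof (induction s)
  case (Suc s)
  then show ?case
    by (cases "t = s") (simp_all add: state.simps next_entry_def Live_def)
qed simp

lemma location_index_eq: "t \<le> s \<Longrightarrow> location_index (state s) (req t) t = index t"
  unfolding location_index_def index_def
  by (rule arg_cong[where f = card]) (use state_live_iff in force)

lemma rp_ge: "s \<le> z \<Longrightarrow> rp s z = z"
  by (simp add: rp_def rep_def)

lemma rp_Suc_le:
  "z \<le> s \<Longrightarrow> rp (Suc s) z =
    (if merging s \<and> rp s z = rp s (source s) then rp s (target s) else rp s z)"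
  by (simp add: rp_def merging_def rep_def[of "Suc s"] state.simps next_entry_def)

text \<open>Flags and location counts below \<open>s\<close> are already final at stage
  \<open>s\<close>, so the table can be replaced by the stage-independent \<open>Live\<close> and
  \<open>index\<close>.\<close>

lemma merging_iff:
  "merging s \<longleftrightarrow> target s < s \<and> source s < s \<and> rp s (target s) \<noteq> rp s (source s) \<and>
    (\<forall>t<s. t \<in> Live \<and> req t < req s \<longrightarrow> (\<forall>z\<le>t. rp s z \<noteq> rp s (source s))) \<and>
    (kind s = 1 \<and> target s \<in> Live \<and> source s \<in> Live \<and>
       req (target s) = req s \<and> req (source s) = req s \<and>
       nsnd (index (target s)) = nsnd (index (source s)) \<and>
       u (nfst (index (target s))) (nfst (index (source s))) s \<or>
     kind s = 2 \<and> (\<exists>v<s. outputs (nfst (req s)) v (source s) s) \<and>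
       \<not> (\<exists>v<s. \<exists>z<s. outputs (nfst (req s)) v z s \<and> rp s z = rp s (target s)))"
proof -
  have live: "nsnd (state s t) \<noteq> 0 \<longleftrightarrow> t \<in> Live" if "t < s" for t
    using that by (rule state_live_iff)
  have ix: "location_index (state s) (req s) t = index t" if "t < s" "req t = req s" for t
    using location_index_eq[of t s] that by simp
  have un: "unrestrained s (state s) \<longleftrightarrow>
      (\<forall>t<s. t \<in> Live \<and> req t < req s \<longrightarrow> (\<forall>z\<le>t. rp s z \<noteq> rp s (source s)))"
    unfolding unrestrained_def rp_def using live by (simp add: less_Suc_eq_le)
  show ?thesis
    unfolding merging_def merges_def un rp_def[symmetric]
    by (intro conj_cong disj_cong refl) (simp_all only: live ix not_False_eq_True)
qed

lemma Live_iff: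
  "s \<in> Live \<longleftrightarrow> kind s = 0 \<and> (\<forall>t<s. t \<in> Live \<and> req t = req s \<longrightarrow>
    (\<forall>x\<le>t. \<forall>x'\<le>t. \<exists>v<s. \<exists>v'<s. outputs (req s) x v s \<and> outputs (req s) x' v' s \<and>
      (rp s x = rp s x' \<longleftrightarrow> r v v' s)))"
proof -
  have "(\<forall>t<s. nsnd (state s t) \<noteq> 0 \<and> req t = req s \<longrightarrow> P t) \<longleftrightarrow>
      (\<forall>t<s. t \<in> Live \<and> req t = req s \<longrightarrow> P t)" for P
    using state_live_iff by blast
  then show ?thesis
    unfolding Live_def mem_Collect_eq goes_live_def[of s] rp_def[symmetric] less_Suc_eq_le
    by simp
qed

text \<open>A stage involves only smaller numbers, so the number \<open>s\<close> is still alone in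
  its class at stage \<open>s\<close>. This is the freshness of a new coding location.\<close>

lemma rp_less: "z < s \<Longrightarrow> rp s z < s"
proof (induction s arbitrary: z)
  case (Suc s)
  have "rp s y < Suc s" if "y \<le> s" for y
  proof (cases "y = s")
    case False
    with that have "rp s y < s" by (intro Suc.IH) simp
    then show ?thesis by simp
  qed (simp add: rp_ge)
  moreover have "target s \<le> s" if "merging s"
    using that unfolding merging_iff by simp
  ultimately show ?case
    using Suc.prems by (simp add: rp_Suc_le less_Suc_eq_le)
qed simp

lemma rp_Suc:
  "rp (Suc s) z = (if merging s \<and> rp s z = rp s (source s) then rp s (target s) else rp s z)"
proof (cases "z \<le> s")
  case False
  have "rp s (source s) < s" if "merging s"
    using that rp_less unfolding merging_iff by blast
  with False show ?thesis by (auto simp: rp_ge)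
qed (rule rp_Suc_le)

text \<open>Representatives change for whole classes at once, so an identification is never
  undone.\<close>

lemma rp_mono: "s \<le> s' \<Longrightarrow> rp s x = rp s y \<Longrightarrow> rp s' x = rp s' y"
  by (induction s' rule: dec_induct) (simp_all add: rp_Suc)

lemma E_I: "rp s x = rp s y \<Longrightarrow> (x, y) \<in> E"
  unfolding E_def by blast

lemma E_eventually: "(x, y) \<in> E \<Longrightarrow> \<exists>N. \<forall>s\<ge>N. rp s x = rp s y"
  unfolding E_def using rp_mono by blast

lemma decidable_rp_eq: "decidable (\<lambda>z. rp (nsnd (nsnd z)) (nfst z) = rp (nsnd (nsnd z)) (nfst (nsnd z)))"
  unfolding rp_def rep_def by (intro computable_intros computable_state)

lemma ceer_E: "ceer E"
proof (rule ceerI)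
  show "ce_rel E"
    by (rule ce_relI[where A = "\<lambda>x y s. rp s x = rp s y"]) (rule decidable_rp_eq, simp add: E_def)
  fix x y z
  show "(x, x) \<in> E" by (rule E_I) (rule refl)
  show "(x, y) \<in> E \<Longrightarrow> (y, x) \<in> E" unfolding E_def by (auto dest: sym)
  assume "(x, y) \<in> E" "(y, z) \<in> E"
  then obtain s s' where "rp s x = rp s y" "rp s' y = rp s' z" unfolding E_def by blast
  then have "rp (max s s') x = rp (max s s') y" "rp (max s s') y = rp (max s s') z"
    by (auto elim: rp_mono[rotated])
  then show "(x, z) \<in> E" by (intro E_I[of "max s s'"]) simp
qed

section \<open>Finite action of the requirements\<close>

definition locations :: "nat \<Rightarrow> nat set" where
  "locations n = {t \<in> Live. req t = n}"

lemma merging_identifies: "merging s \<Longrightarrow> s < s' \<Longrightarrow> rp s' (target s) = rp s' (source s)"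
  by (rule rp_mono[of "Suc s"]) (simp_all add: rp_Suc)

text \<open>A pair of locations is merged at most once, since its representatives agree from then
  on.\<close>

lemma finite_coding_merges:
  assumes "finite (locations n)"
  shows "finite {s. merging s \<and> kind s = 1 \<and> req s = n}" (is "finite ?S")
proof (rule finite_imageD[of "\<lambda>s. (target s, source s)"])
  have "(\<lambda>s. (target s, source s)) ` ?S \<subseteq> locations n \<times> locations n"
    by (auto simp: merging_iff locations_def)
  then show "finite ((\<lambda>s. (target s, source s)) ` ?S)"
    using assms finite_subset by blast
  show "inj_on (\<lambda>s. (target s, source s)) ?S"
  proof (rule linorder_inj_onI)
    fix s s' assume s: "s < s'" "s \<in> ?S" "s' \<in> ?S"
    then have "rp s' (target s) = rp s' (source s)" by (simp add: merging_identifies)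
    moreover have "rp s' (target s') \<noteq> rp s' (source s')"
      using s(3) by (simp add: merging_iff)
    ultimately show "(target s, source s) \<noteq> (target s', source s')" by auto
  qed auto
qed

text \<open>There is at most one such merge: the target is determined by \<open>n\<close>, and after
  the merge a value of the program lies in its class, which blocks any further one.\<close>

lemma finite_range_merges: "finite {s. merging s \<and> kind s = 2 \<and> req s = n}" (is "finite ?S")
proof -
  have no_later: False if s: "s \<in> ?S" "s' \<in> ?S" "s < s'" for s s'
  proof -
    obtain v where v: "v < s" "outputs (nfst n) v (source s) s"
      using s(1) by (auto simp: merging_iff)
    have "target s = target s'" using s(1,2) by (simp add: target_def)
    moreover have "rp s' (target s) = rp s' (source s)"
      using s(1,3) by (simp add: merging_identifies)
    moreover have "outputs (nfst n) v (source s) s'"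
      using v(2) s(3) by (auto elim: outputs_mono)
    moreover have "v < s'" "source s < s'"
      using v(1) s(1,3) by (auto simp: merging_iff)
    ultimately show False
      using s(2) unfolding merging_iff by auto
  qed
  have "?S \<subseteq> {s}" if "s \<in> ?S" for s
    using no_later that by (metis (no_types, lifting) linorder_neqE_nat singletonI subsetI)
  then show ?thesis
    by (metis (no_types, lifting) finite.emptyI finite.insertI finite_subset ex_in_conv)
qed

section \<open>Live stages against reductions of E to R\<close>

lemma infinite_locations_agree:
  assumes "infinite (locations n)"
  shows "\<exists>s\<ge>N. \<exists>v v'. outputs n x v s \<and> outputs n x' v' s \<and> (rp s x = rp s x' \<longleftrightarrow> r v v' s)"
proof -
  \<comment> \<open>The live stage \<open>t\<close> brings \<open>x\<close> and \<open>x'\<close>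
    into the tested segment; the later live stage \<open>s\<close> is the one whose test is read
    off.\<close>
  obtain t where t: "t \<in> locations n" "max x x' \<le> t"
    using assms unfolding infinite_nat_iff_unbounded_le by blast
  obtain s where s: "s \<in> locations n" "max N (Suc t) \<le> s"
    using assms unfolding infinite_nat_iff_unbounded_le by blast
  have "\<exists>v<s. \<exists>v'<s. outputs n x v s \<and> outputs n x' v' s \<and> (rp s x = rp s x' \<longleftrightarrow> r v v' s)"
  proof -
    have st: "s \<in> Live" "req s = n" "t \<in> Live" "req t = n" "t < s" "x \<le> t" "x' \<le> t"
      using s t by (auto simp: locations_def)
    from st(1) have "\<forall>t<s. t \<in> Live \<and> req t = req s \<longrightarrow>
        (\<forall>x\<le>t. \<forall>x'\<le>t. \<exists>v<s. \<exists>v'<s. outputs (req s) x v s \<and> outputs (req s) x' v' s \<and>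
          (rp s x = rp s x' \<longleftrightarrow> r v v' s))"
      unfolding Live_iff[of s] by (rule conjunct2)
    with st show ?thesis by blast
  qed
  moreover have "N \<le> s" using s(2) by simp
  ultimately show ?thesis by blast
qed

text \<open>Agreement at arbitrarily late stages suffices, because both approximations only grow: an
  identification made on one side stays, and is matched on the other at the next agreement.\<close>

lemma reducible_if_infinite_locations:
  assumes "infinite (locations n)"
  shows "E \<le>\<^sub>c R"
proof -
  have "\<exists>v. evaluates (prog n) [x] v" for x
    using infinite_locations_agree[OF assms, of 0 x x] ex_outputs_iff by blast
  then obtain f where f: "\<And>x. evaluates (prog n) [x] (f x)" by metis
  then have "computable f" unfolding computable_def by blast
  have out: "v = f x" if "outputs n x v s" for x v s
    using that ex_outputs_iff evaluates_functional[OF _ f] by blast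
  have agree: "\<exists>s\<ge>N. rp s x = rp s x' \<longleftrightarrow> r (f x) (f x') s" for x x' N
    using infinite_locations_agree[OF assms, of N x x'] out by blast
  have "(x, x') \<in> E \<longleftrightarrow> (f x, f x') \<in> R" for x x'
  proof
    assume "(x, x') \<in> E"
    then obtain N where "\<forall>s\<ge>N. rp s x = rp s x'" using E_eventually by blast
    with agree[of N x x'] show "(f x, f x') \<in> R" unfolding R_iff by blast
  next
    assume "(f x, f x') \<in> R"
    then obtain N where "r (f x) (f x') N" unfolding R_iff by blast
    with agree[of N x x'] r_mono show "(x, x') \<in> E" using E_I by blast
  qed
  with \<open>computable f\<close> show ?thesis unfolding reducible_def by blast
qed

text \<open>For a program computing a true reduction, every single comparison is eventually correct
  forever. With only finitely many locations, all tests would hold from some stage on, and a later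
  stage of kind 0 would be one more location.\<close>

lemma infinite_locations_if_reducible:
  assumes "E \<le>\<^sub>c R"
  shows "\<exists>n. infinite (locations n)"
proof -
  obtain f where f: "computable f" "\<And>x y. (x, y) \<in> E \<longleftrightarrow> (f x, f y) \<in> R"
    using assms unfolding reducible_def by blast
  then obtain p where p: "\<And>x. evaluates p [x] (f x)" unfolding computable_def by blast
  obtain n where n: "prog n = p" using prog_surj by blast
  have "infinite (locations n)"
  proof
    assume fin: "finite (locations n)"
    let ?P = "\<lambda>s x x'. \<exists>v<s. \<exists>v'<s. outputs n x v s \<and> outputs n x' v' s \<and>
      (rp s x = rp s x' \<longleftrightarrow> r v v' s)"
    have ev_out: "\<forall>\<^sub>F s in sequentially. outputs n x (f x) s" for x
    proof -
      obtain s where "outputs n x (f x) s" using p n ex_outputs_iff by blast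
      then show ?thesis unfolding eventually_sequentially using outputs_mono by blast
    qed
    have ev_iff: "\<forall>\<^sub>F s in sequentially. rp s x = rp s x' \<longleftrightarrow> r (f x) (f x') s" for x x'
    proof (cases "(x, x') \<in> E")
      case True
      then obtain N where N: "\<And>s. N \<le> s \<Longrightarrow> rp s x = rp s x'" using E_eventually by blast
      from True f(2) obtain N' where N': "r (f x) (f x') N'" unfolding R_iff by blast
      show ?thesis
        unfolding eventually_sequentially
        using N r_mono[OF N'] by (intro exI[of _ "max N N'"]) simp
    next
      case False
      then show ?thesis using f(2) E_I R_iff by (intro always_eventually) blast
    qed
    have ev: "\<forall>\<^sub>F s in sequentially. ?P s x x'" for x x'
      using ev_out[of x] ev_out[of x'] ev_iff[of x x'] eventually_gt_at_top[of "f x"]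
        eventually_gt_at_top[of "f x'"]
      by eventually_elim blast
    have "\<forall>\<^sub>F s in sequentially. \<forall>t\<in>locations n. \<forall>x\<in>{..t}. \<forall>x'\<in>{..t}. ?P s x x'"
      by (intro eventually_ball_finite ballI fin finite_atMost ev)
    moreover have "\<forall>\<^sub>F s in sequentially. \<forall>t\<in>locations n. t < s"
      by (intro eventually_ball_finite ballI fin eventually_gt_at_top)
    ultimately have "\<forall>\<^sub>F s in sequentially. (\<forall>t\<in>locations n. \<forall>x\<in>{..t}. \<forall>x'\<in>{..t}. ?P s x x') \<and>
        (\<forall>t\<in>locations n. t < s)"
      by (rule eventually_conj)
    then obtain N where N: "\<And>s. N \<le> s \<Longrightarrow> \<forall>t\<in>locations n. \<forall>x\<in>{..t}. \<forall>x'\<in>{..t}. ?P s x x'"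
      "\<And>s. N \<le> s \<Longrightarrow> \<forall>t\<in>locations n. t < s"
      unfolding eventually_sequentially by blast
    define s where "s = stage n 0 0 0 N"
    have "N \<le> s" by (simp add: s_def stage_ge)
    have "kind s = 0" "req s = n" by (simp_all add: s_def)
    have "s \<in> Live"
    proof (rule iffD2[OF Live_iff], intro conjI allI impI)
      show "\<exists>v<s. \<exists>v'<s. outputs (req s) x v s \<and> outputs (req s) x' v' s \<and>
          (rp s x = rp s x' \<longleftrightarrow> r v v' s)"
        if "t < s" "t \<in> Live \<and> req t = req s" "x \<le> t" "x' \<le> t" for t x x'
        using N(1)[OF \<open>N \<le> s\<close>] that \<open>req s = n\<close> by (simp add: locations_def)
    qed fact
    then have "s \<in> locations n" by (simp add: locations_def s_def)
    then show False using N(2)[OF \<open>N \<le> s\<close>] by blast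
  qed
  then show ?thesis ..
qed

lemma index_locations: "t \<in> locations n \<Longrightarrow> index t = card {t' \<in> locations n. t' < t}"
  unfolding index_def locations_def by (rule arg_cong[where f = card]) auto

lemma index_le: "index t \<le> t"
proof -
  have "index t \<le> card {..<t}"
    unfolding index_def by (rule card_mono) auto
  then show ?thesis by simp
qed

text \<open>\<open>index\<close> is the position in the increasing enumeration of the locations, so
  every element of every copy of \<open>U\<close> receives one.\<close>

lemma ex_location_index:
  assumes "infinite (locations n)"
  shows "\<exists>t\<in>locations n. index t = p"
proof (induction p)
  case 0
  obtain t where t: "t \<in> locations n" using assms by fastforce
  let ?t = "LEAST t. t \<in> locations n"
  have "?t \<in> locations n" using t by (rule LeastI)
  moreover have "{t' \<in> locations n. t' < ?t} = {}" using not_less_Least by blast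
  ultimately show ?case by (intro bexI[of _ ?t]) (simp_all add: index_locations)
next
  case (Suc p)
  then obtain t where t: "t \<in> locations n" "index t = p" by blast
  have "\<exists>t'. t' \<in> locations n \<and> t < t'"
    using assms unfolding infinite_nat_iff_unbounded by blast
  then have t': "(LEAST t'. t' \<in> locations n \<and> t < t') \<in> locations n \<and>
      t < (LEAST t'. t' \<in> locations n \<and> t < t')" (is "?t' \<in> _ \<and> _")
    by (rule LeastI_ex)
  have "{t'' \<in> locations n. t'' < ?t'} = insert t {t'' \<in> locations n. t'' < t}"
  proof (intro set_eqI iffI)
    fix t'' assume "t'' \<in> {t'' \<in> locations n. t'' < ?t'}"
    then have "t'' \<in> locations n" "\<not> (t'' \<in> locations n \<and> t < t'')"
      using not_less_Least by blast+
    then show "t'' \<in> insert t {t'' \<in> locations n. t'' < t}" by auto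
  qed (use t(1) t' in auto)
  then have "index ?t' = Suc p"
    using t index_locations[OF conjunct1[OF t']] by (simp add: index_locations)
  with t' show ?case by blast
qed

text \<open>Copy \<open>S\<close> of \<open>U\<close>, where \<open>S\<close> is a stage after which no requirement of higher priority acts, is
  coded at locations that are fresh after stage \<open>S\<close>. Hence only merges of priority \<open>n\<close> can affect
  the classes of these locations, and \<open>E\<close> restricted to them is \<open>U\<close>.\<close>

lemma reducible_if_infinite_locations_least:
  assumes inf: "infinite (locations n)" and fin: "\<And>m. m < n \<Longrightarrow> finite (locations m)"
  shows "U \<le>\<^sub>c E"
proof -
  note U = ceerD[OF ceer_U]
  \<comment> \<open>Range merges of priority \<open>n\<close> itself are included, so that beyond
    \<open>S\<close> only coding merges remain at this priority.\<close>
  let ?B = "(\<Union>m<n. locations m) \<union> (\<Union>m<n. {s. merging s \<and> kind s = 1 \<and> req s = m}) \<union>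
    (\<Union>m\<le>n. {s. merging s \<and> kind s = 2 \<and> req s = m})"
  have "finite ?B"
    using fin by (intro finite_UnI finite_UN_I finite_range_merges finite_coding_merges) auto
  then obtain S where "\<forall>s\<in>?B. s < S"
    unfolding finite_nat_set_iff_bounded by (elim exE)
  then have S: "s < S" if "s \<in> ?B" for s using that by (rule bspec)
  define C where "C = {t \<in> locations n. nsnd (index t) = S}"
  define U' where "U' a b \<longleftrightarrow> nsnd (index a) = nsnd (index b) \<and> (nfst (index a), nfst (index b)) \<in> U"
    for a b
  have U'_refl: "U' a a" and U'_sym: "U' a b \<Longrightarrow> U' b a"
    and U'_trans: "U' a b \<Longrightarrow> U' b c \<Longrightarrow> U' a c" for a b c
    unfolding U'_def
    using U(1) U(2)[of "nfst (index a)" "nfst (index b)"]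
      U(3)[of "nfst (index a)" "nfst (index b)" "nfst (index c)"] by simp_all
  have C_U': "b \<in> C" if "a \<in> C" "U' a b" "b \<in> locations n" for a b
    using that by (simp add: C_def U'_def)
  \<comment> \<open>The copy number doubles as the lower bound: it is at most the index, which is at
    most the location.\<close>
  have C_ge: "S \<le> a" if "a \<in> C" for a
    using that nsnd_le[of "index a"] index_le[of a] by (simp add: C_def)
  \<comment> \<open>The class of a safe number avoids everything restrained by higher priority, so
    the coding merges of this copy are never blocked.\<close>
  define safe where "safe s a \<longleftrightarrow> (\<forall>t\<in>Live. req t < n \<longrightarrow> (\<forall>z\<le>t. rp s z \<noteq> rp s a))" for s a
  \<comment> \<open>The comparison is with all locations of \<open>n\<close>, not just those in
    \<open>C\<close>; this shows that a merge inside another copy leaves the classes of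
    \<open>C\<close> alone.\<close>
  have inv: "a \<in> C \<Longrightarrow> a < s \<Longrightarrow>
      (\<forall>b\<in>locations n. b < s \<longrightarrow> rp s a = rp s b \<longrightarrow> U' a b) \<and> safe s a" for a s
  proof (induction s arbitrary: a)
    case (Suc s)
    note IH = Suc.IH and a = Suc.prems(1)
    have low: "t < S" if "t \<in> Live" "req t < n" for t
      using that by (intro S) (auto simp: locations_def)
    show ?case
    proof (cases "merging s")
      case False
      then have rp: "rp (Suc s) z = rp s z" for z by (simp add: rp_Suc)
      have fresh: "rp s z \<noteq> rp s s" if "z < s" for z
        using rp_less[OF that] by (simp add: rp_ge)
      show ?thesis
      proof (cases "a = s")
        case True
        have "U' a b" if "b < Suc s" "rp s a = rp s b" for b
          using that fresh[of b] True U'_refl by (cases "b = s") auto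
        moreover have "safe s a"
          unfolding safe_def
        proof (intro ballI impI allI)
          fix t z assume "t \<in> Live" "req t < n" "z \<le> t"
          then have "z < s" using low[of t] C_ge[OF a] True by simp
          then show "rp s z \<noteq> rp s a" using fresh True by simp
        qed
        ultimately show ?thesis by (simp add: rp safe_def)
      next
        case False
        with Suc.prems have "a < s" by simp
        with IH[OF a] fresh[of a] show ?thesis
          by (auto simp: rp safe_def less_Suc_eq)
      qed
    next
      case True
      let ?x = "target s" and ?y = "source s"
      note m = True[unfolded merging_iff]
      have "s \<notin> Live" using m Live_iff[THEN iffD1, THEN conjunct1, of s] by auto
      then have "s \<notin> locations n" by (simp add: locations_def)
      then have "a \<noteq> s" using a by (auto simp: C_def)
      with Suc.prems have as: "a < s" by simp
      have bs: "b < s" if "b \<in> locations n" "b < Suc s" for b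
        using that \<open>s \<notin> locations n\<close> by (auto simp: less_Suc_eq)
      have "S \<le> s" using C_ge[OF a] as by simp
      then have "s \<notin> ?B" using S by (meson leD)
      with True m consider "req s > n" | "req s = n" "kind s = 1"
        by (auto simp: not_less le_less)
      then show ?thesis
      proof cases
        case 1
        \<comment> \<open>A live stage of priority \<open>n\<close> restrains the present stage and
          thereby freezes the representatives of all numbers up to it; for the location
          \<open>a\<close> these include all numbers relevant to \<open>safe\<close>.\<close>
        have old: "rp (Suc s) z = rp s z" if "z \<le> t" "t \<in> locations n" "t < s" for z t
          using that m 1 by (auto simp: rp_Suc locations_def)
        have aL: "a \<in> locations n" using a by (simp add: C_def)
        have "rp (Suc s) b = rp s b" if "b \<in> locations n" "b < s" for b
          using old[of b b] that by simp
        moreover have "safe (Suc s) a"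
          unfolding safe_def
        proof (intro ballI impI allI)
          fix t z assume t: "t \<in> Live" "req t < n" "z \<le> t"
          then have "z \<le> a" using low[of t] C_ge[OF a] by simp
          then have "rp (Suc s) z = rp s z" "rp (Suc s) a = rp s a"
            using old[of z a] old[of a a] aL as by auto
          then show "rp (Suc s) z \<noteq> rp (Suc s) a"
            using IH[OF a as] t unfolding safe_def by simp
        qed
        ultimately show ?thesis
          using IH[OF a as] bs aL as by simp
      next
        case 2
        then have x: "?x \<in> locations n" "?x < s" and y: "?y \<in> locations n" "?y < s"
          and "nsnd (index ?x) = nsnd (index ?y)" "u (nfst (index ?x)) (nfst (index ?y)) s"
          using m by (auto simp: locations_def)
        then have xy: "U' ?x ?y" unfolding U'_def U_iff by blast
        have xyC: "?x \<in> C \<longleftrightarrow> ?y \<in> C"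
          using C_U'[of ?x ?y] C_U'[of ?y ?x] U'_sym xy x y by blast
        have IH1: "U' c b" if "c \<in> C" "c < s" "b \<in> locations n" "b < s" "rp s c = rp s b" for b c
          using IH[of c] that by blast
        have IH2: "safe s c" if "c \<in> C" "c < s" for c
          using IH that by blast
        have yC: "?y \<in> C" if "rp s a = rp s ?y"
          using C_U'[OF a IH1[OF a as y that] y(1)] .
        have xC: "?x \<in> C" if "rp s a = rp s ?x"
          using C_U'[OF a IH1[OF a as x that] x(1)] .
        have "U' a b" if b: "b \<in> locations n" "b < s" "rp (Suc s) a = rp (Suc s) b" for b
        proof -
          consider "rp s a = rp s b" | "rp s a = rp s ?y" "rp s b = rp s ?x"
            | "rp s a = rp s ?x" "rp s b = rp s ?y"
            using b(3) by (auto simp: rp_Suc split: if_splits)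
          then show ?thesis
          proof cases
            case 1
            then show ?thesis using IH1[OF a as b(1,2)] by simp
          next
            case 2
            have "U' ?x b" using IH1[OF _ x(2) b(1,2)] yC xyC 2 by simp
            with IH1[OF a as y 2(1)] xy show ?thesis using U'_trans U'_sym by blast
          next
            case 3
            have "U' ?y b" using IH1[OF _ y(2) b(1,2)] xC xyC 3 by simp
            with IH1[OF a as x 3(1)] xy show ?thesis using U'_trans by blast
          qed
        qed
        moreover have "safe (Suc s) a"
          unfolding safe_def
        proof (intro ballI impI allI)
          fix t z assume t: "t \<in> Live" "req t < n" "z \<le> t"
          have z: "rp s z \<noteq> rp s c" if "c \<in> C" "c < s" for c
            using IH2[OF that] t unfolding safe_def by blast
          show "rp (Suc s) z \<noteq> rp (Suc s) a"
            using z[OF a as] z[OF _ x(2)] z[OF _ y(2)] xC yC xyC by (auto simp: rp_Suc)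
        qed
        ultimately show ?thesis using bs by blast
      qed
    qed
  qed simp
  \<comment> \<open>A decidable description of \<open>C\<close>: the flag of stage \<open>t\<close>
    is final at stage \<open>Suc t\<close>, so it can be read off \<open>state\<close>.\<close>
  let ?P = "\<lambda>x t. nsnd (state (Suc t) t) \<noteq> 0 \<and> req t = n \<and>
    card {t'. t' < t \<and> (nsnd (state (Suc t') t') \<noteq> 0 \<and> req t' = n)} = \<langle>x, S\<rangle>"
  have P: "?P x t \<longleftrightarrow> t \<in> C \<and> nfst (index t) = x" for x t
  proof -
    have "nsnd (state (Suc t) t) \<noteq> 0 \<longleftrightarrow> t \<in> Live" for t
      by (rule state_live_iff) simp
    then have "?P x t \<longleftrightarrow> t \<in> locations n \<and> index t = \<langle>x, S\<rangle>"
      unfolding locations_def index_def by auto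
    also have "index t = \<langle>x, S\<rangle> \<longleftrightarrow> nsnd (index t) = S \<and> nfst (index t) = x"
      by (metis nfst_npair nsnd_npair npair_nfst_nsnd)
    finally show ?thesis by (auto simp: C_def)
  qed
  define g where "g x = (LEAST t. ?P x t)" for x
  have ex: "\<exists>t. ?P x t" for x
    using ex_location_index[OF inf, of "\<langle>x, S\<rangle>"] unfolding P C_def by auto
  have g: "g x \<in> C" "nfst (index (g x)) = x" for x
    using LeastI_ex[OF ex[of x], folded g_def] unfolding P by auto
  have "computable g"
    unfolding g_def
    by (intro computable_Least ex) (intro computable_intros computable_state computable_req)
  moreover have "(x, y) \<in> U \<longleftrightarrow> (g x, g y) \<in> E" for x y
  proof
    assume "(g x, g y) \<in> E"
    then obtain N where "\<forall>s\<ge>N. rp s (g x) = rp s (g y)" using E_eventually by blast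
    then have "rp (N + Suc (g x) + Suc (g y)) (g x) = rp (N + Suc (g x) + Suc (g y)) (g y)" by simp
    moreover have "g y \<in> locations n" using g(1) by (auto simp: C_def)
    ultimately have "U' (g x) (g y)"
      using inv[OF g(1)[of x], of "N + Suc (g x) + Suc (g y)"] by simp
    then show "(x, y) \<in> U" by (simp add: U'_def g(2))
  next
    assume "(x, y) \<in> U"
    then obtain s0 where s0: "u x y s0" unfolding U_iff by blast
    \<comment> \<open>The padding component lifts the stage above both locations and above the stage
      where \<open>U\<close> reveals the pair.\<close>
    define s where "s = stage n 1 (g x) (g y) (s0 + Suc (g x) + Suc (g y))"
    have "s0 + Suc (g x) + Suc (g y) \<le> s" by (simp add: s_def stage_ge)
    then have s: "g x < s" "g y < s" "u x y s"
      using u_mono[OF s0] by simp_all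
    have st: "target s = g x" "source s = g y" "kind s = 1" "req s = n"
      by (simp_all add: s_def)
    show "(g x, g y) \<in> E"
    proof (cases "rp s (g x) = rp s (g y)")
      case False
      have L: "g x \<in> Live" "g y \<in> Live" "req (g x) = n" "req (g y) = n"
        "nsnd (index (g x)) = S" "nsnd (index (g y)) = S"
        using g(1)[of x] g(1)[of y] by (simp_all add: C_def locations_def)
      have "\<forall>t<s. t \<in> Live \<and> req t < n \<longrightarrow> (\<forall>z\<le>t. rp s z \<noteq> rp s (g y))"
        using inv[OF g(1)[of y] s(2)] unfolding safe_def by blast
      with False have "merging s"
        unfolding merging_iff st by (simp add: L s g(2))
      then show ?thesis
        using merging_identifies[of s "Suc s"] E_I[of "Suc s"] st by simp
    qed (rule E_I)
  qed
  ultimately show ?thesis unfolding reducible_def by blast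
qed

text \<open>The induction hypothesis says that no smaller requirement has infinitely many locations.
  If \<open>n\<close> had, \<open>U\<close> would reduce to \<open>E\<close> and \<open>E\<close> to
  \<open>R\<close>.\<close>

lemma finite_locations:
  assumes "\<not> U \<le>\<^sub>c R"
  shows "finite (locations n)"
proof (induction n rule: less_induct)
  case (less n)
  show ?case
  proof (rule ccontr)
    assume "infinite (locations n)"
    then have "U \<le>\<^sub>c E" "E \<le>\<^sub>c R"
      using reducible_if_infinite_locations_least less reducible_if_infinite_locations by blast+
    then show False using assms reducible_trans by blast
  qed
qed

lemma not_reducible:
  assumes "\<not> U \<le>\<^sub>c R"
  shows "\<not> E \<le>\<^sub>c R"
  using infinite_locations_if_reducible finite_locations[OF assms] by blast

text \<open>The requirement for the program of \<open>f\<close> and \<open>x\<close> faces a finite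
  restraint only, and infinitely many inequivalent values give one that escapes it. \<open>g\<close>
  serves only to express this infinity.\<close>

lemma range_meets_every_class:
  fixes g :: "nat \<Rightarrow> nat"
  assumes "\<not> U \<le>\<^sub>c R" "computable f" and g: "\<And>i j. i \<noteq> j \<Longrightarrow> (f (g i), f (g j)) \<notin> E"
  shows "\<exists>v. (f v, x) \<in> E"
proof -
  note E = ceerD[OF ceer_E]
  obtain p where p: "\<And>v. evaluates p [v] (f v)" using assms(2) unfolding computable_def by blast
  obtain i where i: "prog i = p" using prog_surj by blast
  define n where "n = \<langle>i, x\<rangle>"
  have "finite (\<Union>m<n. locations m)"
    using finite_locations[OF assms(1)] by simp
  then obtain B where "\<forall>t\<in>\<Union>m<n. locations m. t < B"
    unfolding finite_nat_set_iff_bounded by (elim exE)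
  then have B: "t < B" if "t \<in> Live" "req t < n" for t
    using that by (simp add: locations_def)
  \<comment> \<open>Pigeonhole: otherwise infinitely many pairwise inequivalent values would lie in
    the classes of the numbers below \<open>B\<close>.\<close>
  obtain v where v: "\<And>z. z < B \<Longrightarrow> (z, f v) \<notin> E"
  proof (rule ccontr)
    assume "\<not> thesis"
    with that have "\<forall>k. \<exists>z<B. (z, f (g k)) \<in> E" by blast
    then obtain c where c: "\<And>k. c k < B" "\<And>k. (c k, f (g k)) \<in> E" by metis
    have "inj c"
    proof (rule injI, rule ccontr)
      fix k l assume "c k = c l" "k \<noteq> l"
      then have "(f (g k), f (g l)) \<in> E"
        using E(3)[OF E(2)[OF c(2)[of k]], of "f (g l)"] c(2)[of l] by simp
      then show False using g[OF \<open>k \<noteq> l\<close>] by simp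
    qed
    moreover have "range c \<subseteq> {..<B}" using c(1) by blast
    ultimately show False
      using finite_subset range_inj_infinite by blast
  qed
  obtain s0 where s0: "outputs i v (f v) s0" using p i ex_outputs_iff by blast
  define s where "s = stage n 2 0 (f v) (s0 + Suc v + Suc (f v) + Suc x)"
  have "s0 + Suc v + Suc (f v) + Suc x \<le> s" by (simp add: s_def stage_ge)
  then have s: "v < s" "f v < s" "x < s" "outputs i v (f v) s"
    using outputs_mono[OF s0] by simp_all
  have st: "target s = x" "source s = f v" "kind s = 2" "req s = n" "nfst n = i"
    by (simp_all add: s_def n_def)
  \<comment> \<open>At such a late stage either a value has already reached the class of
    \<open>x\<close>, or nothing prevents the merge of \<open>f v\<close> into it.\<close>
  show ?thesis
  proof (cases "\<exists>w<s. \<exists>z<s. outputs i w z s \<and> rp s z = rp s x")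
    case True
    then obtain w z where w: "outputs i w z s" "rp s z = rp s x" by blast
    have "evaluates p [w] z" using w(1) ex_outputs_iff i by blast
    then have "z = f w" using p evaluates_functional by blast
    then show ?thesis using E_I[OF w(2)] by blast
  next
    case False
    have "\<forall>t<s. t \<in> Live \<and> req t < n \<longrightarrow> (\<forall>z\<le>t. rp s z \<noteq> rp s (f v))"
    proof (intro allI impI notI)
      fix t z assume "t \<in> Live \<and> req t < n" "z \<le> t" "rp s z = rp s (f v)"
      then have "z < B" "(z, f v) \<in> E" using B[of t] E_I by auto
      then show False using v by blast
    qed
    moreover have "rp s x \<noteq> rp s (f v)" using False s by metis
    ultimately have "merging s"
      unfolding merging_iff st using False s by auto
    then have "rp (Suc s) x = rp (Suc s) (f v)"
      using merging_identifies[of s "Suc s"] st by simp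
    then show ?thesis using E_I[OF sym] by blast
  qed
qed

end

section \<open>Dark minimal ceers and the infinite family\<close>

definition minimal_over_finite :: "nat rel \<Rightarrow> bool" where
  "minimal_over_finite E \<longleftrightarrow> (\<forall>X. ceer X \<longrightarrow> X <\<^sub>c E \<longrightarrow> (\<exists>n\<ge>1. X \<le>\<^sub>c Id_mod n))"

lemma not_reducible_Id_mod:
  assumes "equiv UNIV X" "infinite (UNIV // X)" "1 \<le> n"
  shows "\<not> X \<le>\<^sub>c Id_mod n"
proof
  assume "X \<le>\<^sub>c Id_mod n"
  then obtain f where f: "\<And>x y. (x, y) \<in> X \<longleftrightarrow> f x mod n = f y mod n"
    unfolding reducible_def Id_mod_def by auto
  obtain g :: "nat \<Rightarrow> nat" where g: "\<And>i j. i \<noteq> j \<Longrightarrow> (g i, g j) \<notin> X"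
    using assms(2) unfolding infinite_classes_iff[OF assms(1)] by blast
  have "inj (\<lambda>i. f (g i) mod n)"
  proof (rule injI, rule ccontr)
    fix i j assume "f (g i) mod n = f (g j) mod n" "i \<noteq> j"
    then show False using f[of "g i" "g j"] g[of i j] by simp
  qed
  moreover have "range (\<lambda>i. f (g i) mod n) \<subseteq> {..<n}" using assms(3) by auto
  ultimately show False
    using finite_subset range_inj_infinite by blast
qed

text \<open>Having infinitely many classes comes for free: an \<open>E\<close> with finitely many classes would
  reduce to \<open>R\<close>.\<close>

lemma ex_dark_minimal_not_reducible:
  assumes R: "ceer R" "\<not> universal R" "infinite (UNIV // R)"
  shows "\<exists>E. dark E \<and> \<not> E \<le>\<^sub>c R \<and> minimal_over_finite E"
proof -
  obtain U where U: "ceer U" "\<not> U \<le>\<^sub>c R"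
    using R(1,2) unfolding universal_def by blast
  have "ce_rel R" "ce_rel U" using R(1) U(1) by (simp_all add: ceer_def)
  obtain r where r: "decidable (\<lambda>z. r (nfst z) (nfst (nsnd z)) (nsnd (nsnd z)))"
    "\<forall>x y s s'. r x y s \<longrightarrow> s \<le> s' \<longrightarrow> r x y s'" "\<forall>x y. (x, y) \<in> R \<longleftrightarrow> (\<exists>s. r x y s)"
    by (rule ce_relE[OF \<open>ce_rel R\<close>])
  obtain u where u: "decidable (\<lambda>z. u (nfst z) (nfst (nsnd z)) (nsnd (nsnd z)))"
    "\<forall>x y s s'. u x y s \<longrightarrow> s \<le> s' \<longrightarrow> u x y s'" "\<forall>x y. (x, y) \<in> U \<longleftrightarrow> (\<exists>s. u x y s)"
    by (rule ce_relE[OF \<open>ce_rel U\<close>])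
  interpret priority R U r u
    using R(1) U(1) r u by unfold_locales blast+
  note E = ceerD[OF ceer_E]
  have eq: "equiv UNIV E" using ceer_E by (simp add: ceer_def)
  have not_red: "\<not> E \<le>\<^sub>c R" using not_reducible[OF U(2)] .
  have inf: "infinite (UNIV // E)"
    using finite_classes_reducible_infinite[OF ceer_E _ R(1,3)] not_red by blast
  have meets: "\<exists>v. (f v, x) \<in> E"
    if "computable f" "\<And>i j. i \<noteq> j \<Longrightarrow> (f (g i), f (g j)) \<notin> E" for f g :: "nat \<Rightarrow> nat" and x
    using range_meets_every_class[OF U(2) that] .
  have "\<not> Id \<le>\<^sub>c E"
  proof
    assume "Id \<le>\<^sub>c E"
    then obtain f where f: "computable f" "\<And>x y. x = y \<longleftrightarrow> (f x, f y) \<in> E"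
      unfolding reducible_def by auto
    \<comment> \<open>The shift leaves out the class of \<open>f 0\<close> but still has infinitely
      many inequivalent values.\<close>
    have "computable (\<lambda>x. f (Suc x))"
      by (rule computable_compose[OF f(1) computable_Suc])
    moreover have "(f (Suc i), f (Suc j)) \<notin> E" if "i \<noteq> j" for i j
      using f(2)[of "Suc i" "Suc j"] that by simp
    ultimately obtain v where "(f (Suc v), f 0) \<in> E"
      using meets[of "\<lambda>x. f (Suc x)" "\<lambda>i. i" "f 0"] by blast
    then show False using f(2)[of "Suc v" 0] by simp
  qed
  then have "dark E" using ceer_E inf by (simp add: dark_def)
  moreover have "\<exists>n\<ge>1. X \<le>\<^sub>c Id_mod n" if X: "ceer X" "X <\<^sub>c E" for X
  proof (rule finite_classes_reducible_Id_mod[OF X(1)], rule ccontr)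
    assume inf_X: "infinite (UNIV // X)"
    have eq_X: "equiv UNIV X" using X(1) by (simp add: ceer_def)
    obtain g :: "nat \<Rightarrow> nat" where g: "\<And>i j. i \<noteq> j \<Longrightarrow> (g i, g j) \<notin> X"
      using inf_X unfolding infinite_classes_iff[OF eq_X] by blast
    obtain f where f: "computable f" "\<And>x y. (x, y) \<in> X \<longleftrightarrow> (f x, f y) \<in> E"
      using X(2) unfolding strictly_reducible_def reducible_def by blast
    have "(f (g i), f (g j)) \<notin> E" if "i \<noteq> j" for i j
      using g[OF that] f(2) by blast
    then have onto: "\<exists>v. (f v, x) \<in> E" for x
      using meets[OF f(1)] by blast
    have "ce_rel E" using ceer_E by (simp add: ceer_def)
    then obtain A where A: "decidable (\<lambda>z. A (nfst z) (nfst (nsnd z)) (nsnd (nsnd z)))"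
      "\<forall>x y s s'. A x y s \<longrightarrow> s \<le> s' \<longrightarrow> A x y s'" "\<forall>x y. (x, y) \<in> E \<longleftrightarrow> (\<exists>s. A x y s)"
      by (rule ce_relE)
    have "ce_rel {(x, v). (f v, x) \<in> E}"
      by (rule ce_relI[where A = "\<lambda>x v s. A (f v) x s"])
        (intro computable_intros decidable_compose3[of A, OF A(1)] computable_compose[OF f(1)],
          simp add: A(3))
    then obtain h where h: "computable h" "\<And>x. (f (h x), x) \<in> E"
      using computable_choice[of "{(x, v). (f v, x) \<in> E}"] onto by auto
    have "(x, y) \<in> E \<longleftrightarrow> (h x, h y) \<in> X" for x y
    proof
      assume "(x, y) \<in> E"
      then have "(f (h x), f (h y)) \<in> E" by (rule E(3)[OF h(2) E(3)[OF _ E(2)[OF h(2)]]])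
      then show "(h x, h y) \<in> X" using f(2) by blast
    next
      assume "(h x, h y) \<in> X"
      then have "(f (h x), f (h y)) \<in> E" using f(2) by blast
      then show "(x, y) \<in> E" by (rule E(3)[OF E(2)[OF h(2)] E(3)[OF _ h(2)]])
    qed
    with h(1) have "E \<le>\<^sub>c X" unfolding reducible_def by blast
    then show False using X(2) by (simp add: strictly_reducible_def)
  qed
  ultimately show ?thesis
    using not_red unfolding minimal_over_finite_def by blast
qed

theorem theorem3p3:
  fixes R :: "nat rel"
  assumes "ceer R"
    and "\<not> universal R"
  shows "\<exists>E :: nat \<Rightarrow> nat rel.
    (\<forall>l. dark (E l)) \<and>
    (\<forall>l m. l \<noteq> m \<longrightarrow> \<not> E l \<le>\<^sub>c E m \<and> \<not> E m \<le>\<^sub>c E l) \<and>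
    (\<forall>l. \<not> E l \<le>\<^sub>c R \<and>
         (\<forall>X. ceer X \<longrightarrow> X <\<^sub>c E l \<longrightarrow> (\<exists>n\<ge>1. X \<le>\<^sub>c Id_mod n)))"
proof -
  \<comment> \<open>\<open>R \<le>\<^sub>c S\<close> is carried along so that avoiding
    \<open>S\<close> also avoids \<open>R\<close>.\<close>
  define good where "good S \<longleftrightarrow> ceer S \<and> \<not> universal S \<and> infinite (UNIV // S) \<and> R \<le>\<^sub>c S" for S
  define new where "new S E \<longleftrightarrow> dark E \<and> \<not> E \<le>\<^sub>c S \<and> minimal_over_finite E" for S E
  have ex_new: "\<exists>E. new S E" if "good S" for S
    using ex_dark_minimal_not_reducible that unfolding good_def new_def by blast
  have start: "\<exists>S. good S"
  proof (cases "infinite (UNIV // R)")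
    case True
    have "R \<le>\<^sub>c R"
      unfolding reducible_def by (intro exI[of _ "\<lambda>x. x"]) (simp add: computable_id)
    then show ?thesis using assms True unfolding good_def by blast
  next
    case False
    have "infinite (UNIV // (Id :: nat rel))"
      unfolding infinite_classes_iff[OF ceer_Id[unfolded ceer_def, THEN conjunct1]]
      by (intro exI[of _ "\<lambda>i. i"]) simp
    moreover from this have "R \<le>\<^sub>c Id"
      using finite_classes_reducible_infinite[OF assms(1) _ ceer_Id] False by blast
    ultimately show ?thesis
      using ceer_Id not_universal_Id unfolding good_def by blast
  qed
  \<comment> \<open>Each pair consists of a ceer and a dark one not reducible to it; the next first
    component is their join, and so bounds all dark ceers chosen before.\<close>
  have "\<exists>F. \<forall>l. (good (fst (F l)) \<and> new (fst (F l)) (snd (F l))) \<and>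
      (fst (F l) \<le>\<^sub>c fst (F (Suc l)) \<and> snd (F l) \<le>\<^sub>c fst (F (Suc l)))"
  proof (rule dependent_nat_choice)
    show "\<exists>F. good (fst F) \<and> new (fst F) (snd F)"
      using start ex_new by auto
    fix F :: "nat rel \<times> nat rel" and l :: nat
    assume F: "good (fst F) \<and> new (fst F) (snd F)"
    let ?J = "join (fst F) (snd F)"
    have "ceer (fst F)" "ceer (snd F)"
      using F by (simp_all add: good_def new_def dark_def)
    then have J: "ceer ?J" by (rule ceer_join)
    have "infinite (UNIV // ?J)"
      using F J by (intro infinite_classes_reducible[OF _ _ reducible_join_left[of "fst F" "snd F"]])
        (simp_all add: good_def ceer_def)
    moreover have "\<not> universal ?J"
      using F by (intro not_universal_join) (simp_all add: good_def new_def)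
    moreover have "R \<le>\<^sub>c ?J"
      using F reducible_trans[OF _ reducible_join_left] by (simp add: good_def)
    ultimately have "good ?J" using J by (simp add: good_def)
    then obtain E where "new ?J E" using ex_new by blast
    with \<open>good ?J\<close> show "\<exists>G. (good (fst G) \<and> new (fst G) (snd G)) \<and>
        (fst F \<le>\<^sub>c fst G \<and> snd F \<le>\<^sub>c fst G)"
      by (intro exI[of _ "(?J, E)"]) (simp add: reducible_join_left reducible_join_right)
  qed
  then obtain F where F: "\<And>l. good (fst (F l))" "\<And>l. new (fst (F l)) (snd (F l))"
    "\<And>l. fst (F l) \<le>\<^sub>c fst (F (Suc l))" "\<And>l. snd (F l) \<le>\<^sub>c fst (F (Suc l))"
    by blast
  define E where "E l = snd (F l)" for l
  have E: "dark (E l)" "\<not> E l \<le>\<^sub>c fst (F l)" "minimal_over_finite (E l)" for l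
    using F(2)[of l] by (simp_all add: new_def E_def)
  have later: "E l \<le>\<^sub>c fst (F m)" if "l < m" for l m
    using Suc_leI[OF that]
  proof (induction m rule: dec_induct)
    case base
    then show ?case using F(4) by (simp add: E_def)
  next
    case (step m)
    then show ?case using F(3) reducible_trans by blast
  qed
  have backward: "\<not> E m \<le>\<^sub>c E l" if "l < m" for l m
    using E(2) later[OF that] reducible_trans by blast
  \<comment> \<open>Together with \<open>backward\<close>, such a reduction would be strict, so
    minimality of \<open>E m\<close> would leave \<open>E l\<close> with only finitely many
    classes.\<close>
  have forward: "\<not> E l \<le>\<^sub>c E m" if "l < m" for l m
  proof
    assume "E l \<le>\<^sub>c E m"
    with backward[OF that] have "E l <\<^sub>c E m" by (simp add: strictly_reducible_def)
    moreover have l: "ceer (E l)" "infinite (UNIV // E l)" using E(1)[of l] by (simp_all add: dark_def)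
    ultimately obtain n where "1 \<le> n" "E l \<le>\<^sub>c Id_mod n"
      using E(3)[of m] unfolding minimal_over_finite_def by blast
    then show False
      using not_reducible_Id_mod l by (simp add: ceer_def)
  qed
  have "\<not> E l \<le>\<^sub>c R" for l
    using E(2) F(1)[of l] reducible_trans unfolding good_def by blast
  moreover have "\<not> E l \<le>\<^sub>c E m \<and> \<not> E m \<le>\<^sub>c E l" if "l \<noteq> m" for l m
    using forward backward that by (meson linorder_neqE_nat)
  ultimately show ?thesis
    using E unfolding minimal_over_finite_def by blast
qed

end
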